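(* Let $G$ be a plane graph whose set of vertices has no accumulation point in $\mathbb{R}^2$ and which has bounded vertex degrees. If $G$ is hyperbolic and weakly non-amenable, then there exists $k$ such that for every cycle $C\subset G$ the number of faces of $G$ inside $C$ is at most $k|C|$.
   Context: A plane graph is a graph with a fixed embedding in $\mathbb{R}^2$ with no two edges crossing. A face is a connected component of $\mathbb{R}^2$ minus the image of the graph; a face is inside a cycle $C$ if it lies in the bounded component of $\mathbb{R}^2\setminus C$. For finite $S\subset V(G)$, $\partial S$ is the set of vertices outside $S$ adjacent to a vertex of $S$; $G$ is weakly non-amenable if there is a monotone increasing diverging $f:\mathbb{N}\to\mathbb{N}$ with $|S|\le f(|\partial S|)$ for all non-empty finite $S$. A graph is hyperbolic if there is $\delta\ge0$ such that in each connected component every geodetic triangle (three vertices joined pairwise by geodesics) has each side in the $\delta$-neighbourhood of the union of the other two. *)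

theory Defs
  imports "HOL-Analysis.Analysis"
begin

definition simple_graph :: "'v set \<Rightarrow> ('v \<Rightarrow> 'v \<Rightarrow> bool) \<Rightarrow> bool" where
  "simple_graph V E \<longleftrightarrow>
     (\<forall>u v. E u v \<longrightarrow> u \<in> V \<and> v \<in> V) \<and>
     (\<forall>u v. E u v \<longrightarrow> E v u) \<and> (\<forall>u. \<not> E u u)"

definition plane_graph ::
  "'v set \<Rightarrow> ('v \<Rightarrow> 'v \<Rightarrow> bool) \<Rightarrow> ('v \<Rightarrow> real^2) \<Rightarrow> ('v \<Rightarrow> 'v \<Rightarrow> real \<Rightarrow> real^2) \<Rightarrow> bool" where
  "plane_graph V E pos emb \<longleftrightarrow>
     simple_graph V E \<and> inj_on pos V \<and>
     (\<forall>u v. E u v \<longrightarrow>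
        arc (emb u v) \<and> pathstart (emb u v) = pos u \<and> pathfinish (emb u v) = pos v \<and>
        path_image (emb v u) = path_image (emb u v) \<and>
        path_image (emb u v) \<inter> pos ` V \<subseteq> {pos u, pos v}) \<and>
     (\<forall>u v x y. E u v \<longrightarrow> E x y \<longrightarrow> {u, v} \<noteq> {x, y} \<longrightarrow>
        path_image (emb u v) \<inter> path_image (emb x y) \<subseteq> pos ` ({u, v} \<inter> {x, y}))"

definition graph_image ::
  "'v set \<Rightarrow> ('v \<Rightarrow> 'v \<Rightarrow> bool) \<Rightarrow> ('v \<Rightarrow> real^2) \<Rightarrow> ('v \<Rightarrow> 'v \<Rightarrow> real \<Rightarrow> real^2) \<Rightarrow> (real^2) set" where
  "graph_image V E pos emb = pos ` V \<union> (\<Union>{path_image (emb u v) | u v. E u v})"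

definition faces ::
  "'v set \<Rightarrow> ('v \<Rightarrow> 'v \<Rightarrow> bool) \<Rightarrow> ('v \<Rightarrow> real^2) \<Rightarrow> ('v \<Rightarrow> 'v \<Rightarrow> real \<Rightarrow> real^2) \<Rightarrow> (real^2) set set" where
  "faces V E pos emb = components (- graph_image V E pos emb)"

definition is_cycle :: "'v set \<Rightarrow> ('v \<Rightarrow> 'v \<Rightarrow> bool) \<Rightarrow> 'v list \<Rightarrow> bool" where
  "is_cycle V E C \<longleftrightarrow> length C \<ge> 3 \<and> distinct C \<and> set C \<subseteq> V \<and>
     (\<forall>i < length C. E (C ! i) (C ! ((i + 1) mod length C)))"

definition cycle_image ::
  "('v \<Rightarrow> 'v \<Rightarrow> real \<Rightarrow> real^2) \<Rightarrow> 'v list \<Rightarrow> (real^2) set" where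
  "cycle_image emb C = (\<Union>i < length C. path_image (emb (C ! i) (C ! ((i + 1) mod length C))))"

definition faces_inside ::
  "'v set \<Rightarrow> ('v \<Rightarrow> 'v \<Rightarrow> bool) \<Rightarrow> ('v \<Rightarrow> real^2) \<Rightarrow> ('v \<Rightarrow> 'v \<Rightarrow> real \<Rightarrow> real^2) \<Rightarrow> 'v list \<Rightarrow> (real^2) set set" where
  "faces_inside V E pos emb C = {F \<in> faces V E pos emb. F \<subseteq> inside (cycle_image emb C)}"

definition walk :: "'v set \<Rightarrow> ('v \<Rightarrow> 'v \<Rightarrow> bool) \<Rightarrow> 'v list \<Rightarrow> bool" where
  "walk V E xs \<longleftrightarrow> xs \<noteq> [] \<and> set xs \<subseteq> V \<and> (\<forall>i. Suc i < length xs \<longrightarrow> E (xs ! i) (xs ! Suc i))"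

definition gdist :: "'v set \<Rightarrow> ('v \<Rightarrow> 'v \<Rightarrow> bool) \<Rightarrow> 'v \<Rightarrow> 'v \<Rightarrow> nat" where
  "gdist V E u v = (LEAST n. \<exists>xs. walk V E xs \<and> hd xs = u \<and> last xs = v \<and> length xs = Suc n)"

definition geodesic :: "'v set \<Rightarrow> ('v \<Rightarrow> 'v \<Rightarrow> bool) \<Rightarrow> 'v list \<Rightarrow> 'v \<Rightarrow> 'v \<Rightarrow> bool" where
  "geodesic V E xs u v \<longleftrightarrow> walk V E xs \<and> hd xs = u \<and> last xs = v \<and>
     length xs = Suc (gdist V E u v)"

definition near_union ::
  "'v set \<Rightarrow> ('v \<Rightarrow> 'v \<Rightarrow> bool) \<Rightarrow> real \<Rightarrow> 'v list \<Rightarrow> 'v list \<Rightarrow> 'v list \<Rightarrow> bool" where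
  "near_union V E \<delta> P Q R \<longleftrightarrow>
     (\<forall>w \<in> set P. \<exists>w' \<in> set Q \<union> set R. real (gdist V E w w') \<le> \<delta>)"

text \<open>Hyperbolic: uniform \<delta> such that every geodetic triangle (necessarily within a
  component, since geodesics only join vertices of the same component) is \<delta>-thin.\<close>

definition hyperbolic_graph :: "'v set \<Rightarrow> ('v \<Rightarrow> 'v \<Rightarrow> bool) \<Rightarrow> bool" where
  "hyperbolic_graph V E \<longleftrightarrow> (\<exists>\<delta>::real. \<delta> \<ge> 0 \<and>
     (\<forall>x y z P Q R. geodesic V E P x y \<longrightarrow> geodesic V E Q y z \<longrightarrow> geodesic V E R x z \<longrightarrow>
        near_union V E \<delta> P Q R \<and> near_union V E \<delta> Q P R \<and> near_union V E \<delta> R P Q))"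

definition vboundary :: "'v set \<Rightarrow> ('v \<Rightarrow> 'v \<Rightarrow> bool) \<Rightarrow> 'v set \<Rightarrow> 'v set" where
  "vboundary V E S = {u \<in> V. u \<notin> S \<and> (\<exists>s \<in> S. E s u)}"

definition weakly_non_amenable :: "'v set \<Rightarrow> ('v \<Rightarrow> 'v \<Rightarrow> bool) \<Rightarrow> bool" where
  "weakly_non_amenable V E \<longleftrightarrow> (\<exists>f :: nat \<Rightarrow> nat. mono f \<and> filterlim f at_top at_top \<and>
     (\<forall>S. S \<subseteq> V \<longrightarrow> finite S \<longrightarrow> S \<noteq> {} \<longrightarrow> card S \<le> f (card (vboundary V E S))))"

definition bounded_degree :: "'v set \<Rightarrow> ('v \<Rightarrow> 'v \<Rightarrow> bool) \<Rightarrow> bool" where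
  "bounded_degree V E \<longleftrightarrow> (\<exists>d::nat. \<forall>v \<in> V. finite {u. E v u} \<and> card {u. E v u} \<le> d)"

end

theory Submission
  imports Defs "HOL-Complex_Analysis.Complex_Analysis"
begin

text \<open>In a hyperbolic graph every long closed walk contains a non-geodesic subwalk of bounded length,
  so by Dehn's algorithm a cycle of length \<open>n\<close> is a sum of at most \<open>n\<close> closed walks of bounded
  length. Winding numbers are additive under this decomposition, hence each face inside the cycle lies
  inside one of the short walks. The vertices inside a short closed walk have their boundary on the
  walk, so weak non-amenability bounds their number. Finally, the complement of a plane union
  of \<open>N\<close> arcs has at most \<open>N\<close> bounded components: given a point \<open>p\<close> in each of more than \<open>N\<close>
  bounded components, the branch defects of \<open>log (x - p)\<close> along the arcs are linearly dependent over
  the integers, so some nontrivial product of powers of the \<open>x - p\<close> has a continuous logarithm on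
  the union, which is impossible.\<close>

section \<open>Bounded complementary components of a union of arcs\<close>

text \<open>Gaussian elimination without division: a pivot \<open>k\<close> with
  \<open>v k e \<noteq> 0\<close> clears the coordinate \<open>e\<close>, and the induction
  hypothesis applies to the remaining vectors and coordinates.\<close>

lemma int_vectors_dependent:
  fixes v :: "'i \<Rightarrow> 'e \<Rightarrow> int"
  assumes "finite J" "finite I" "card J < card I"
  obtains m where "\<exists>i\<in>I. m i \<noteq> 0" "\<And>e. e \<in> J \<Longrightarrow> (\<Sum>i\<in>I. m i * v i e) = 0"
proof -
  have "\<exists>m. (\<exists>i\<in>I. m i \<noteq> 0) \<and> (\<forall>e\<in>J. (\<Sum>i\<in>I. m i * v i e) = 0)"
    using assms
  proof (induction J arbitrary: I v rule: finite_induct)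
    case empty
    then obtain i where "i \<in> I"
      by fastforce
    then show ?case
      by (intro exI[of _ "\<lambda>_. 1"]) auto
  next
    case (insert e J)
    show ?case
    proof (cases "\<forall>i\<in>I. v i e = 0")
      case True
      moreover have "card J < card I"
        using insert by simp
      ultimately show ?thesis
        using insert.IH[of I v] insert.prems by auto
    next
      case False
      then obtain k where k: "k \<in> I" "v k e \<noteq> 0"
        by blast
      \<comment> \<open>Cross-multiplication keeps the entries integral and makes every
        \<open>w i e\<close> zero.\<close>
      define w where "w i x = v k e * v i x - v i e * v k x" for i x
      have "finite (I - {k})" "card J < card (I - {k})"
        using insert k by auto
      from insert.IH[OF this, of w] obtain m
        where m: "\<exists>i\<in>I - {k}. m i \<noteq> 0" "\<And>x. x \<in> J \<Longrightarrow> (\<Sum>i\<in>I - {k}. m i * w i x) = 0"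
        by blast
      \<comment> \<open>Scaling by the pivot and solving for the coefficient of \<open>k\<close>
        makes the combination of the \<open>v i\<close> equal to that of the \<open>w i\<close> in
        every coordinate, including \<open>e\<close>.\<close>
      define m' where "m' i = (if i = k then - (\<Sum>i\<in>I - {k}. m i * v i e) else v k e * m i)" for i
      have "(\<Sum>i\<in>I. m' i * v i x) = (\<Sum>i\<in>I - {k}. m i * w i x)" for x
      proof -
        have "(\<Sum>i\<in>I. m' i * v i x) = m' k * v k x + (\<Sum>i\<in>I - {k}. m' i * v i x)"
          using insert.prems k by (simp add: sum.remove)
        also have "(\<Sum>i\<in>I - {k}. m' i * v i x) = (\<Sum>i\<in>I - {k}. v k e * m i * v i x)"
          by (rule sum.cong) (auto simp: m'_def)
        also have "m' k * v k x = - (\<Sum>i\<in>I - {k}. m i * v i e * v k x)"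
          by (simp add: m'_def sum_distrib_right)
        finally show ?thesis
          by (simp add: w_def right_diff_distrib sum_subtractf mult_ac)
      qed
      moreover have "(\<Sum>i\<in>I - {k}. m i * w i e) = 0"
        by (simp add: w_def)
      ultimately have "\<forall>x\<in>insert e J. (\<Sum>i\<in>I. m' i * v i x) = 0"
        using m by auto
      moreover have "\<exists>i\<in>I. m' i \<noteq> 0"
        using m(1) k by (auto simp: m'_def)
      ultimately show ?thesis
        by blast
    qed
  qed
  then show thesis
    using that by blast
qed

text \<open>Along the circle, subtracting \<i> n t from the logarithm leaves a continuous function
  with constant exponential. Its values differ by multiples of 2 \<pi> \<i>, so it is constant, and
  comparing the angles 0 and 2 \<pi> forces n = 0.\<close>

lemma power_int_log_on_sphere_imp_zero:
  fixes M :: "complex \<Rightarrow> complex"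
  assumes M: "continuous_on (sphere a R) M" and "R > 0"
    and eq: "\<And>x. x \<in> sphere a R \<Longrightarrow> exp (M x) = (x - a) powi n"
  shows "n = 0"
proof -
  define \<gamma> where "\<gamma> t = a + of_real R * cis t" for t
  define \<phi> where "\<phi> t = M (\<gamma> t) - \<i> * of_real (of_int n * t)" for t
  have \<gamma>: "\<gamma> t \<in> sphere a R" for t
    using \<open>R > 0\<close> by (simp add: \<gamma>_def dist_norm norm_mult)
  have "continuous_on {0..2*pi} (M \<circ> \<gamma>)"
    by (rule continuous_on_compose)
      (auto simp: \<gamma>_def[abs_def] intro!: continuous_intros continuous_on_subset[OF M] \<gamma>[unfolded \<gamma>_def])
  then have cont: "continuous_on {0..2*pi} \<phi>"
    unfolding \<phi>_def o_def by (intro continuous_intros)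
  have exp\<phi>: "exp (\<phi> t) = of_real R powi n" for t
  proof -
    have "exp (M (\<gamma> t)) = (of_real R * cis t) powi n"
      using eq[OF \<gamma>] by (simp add: \<gamma>_def)
    also have "\<dots> = of_real R powi n * cis (of_int n * t)"
      by (simp add: power_int_mult_distrib cis_power_int)
    finally show ?thesis
      using cis_neq_zero
      by (simp add: \<phi>_def exp_diff cis_conv_exp)
  qed
  have "\<phi> constant_on {0..2*pi}"
  proof (rule continuous_discrete_range_constant[OF _ cont])
    show "\<exists>e>0. \<forall>y. y \<in> {0..2*pi} \<and> \<phi> y \<noteq> \<phi> x \<longrightarrow> e \<le> norm (\<phi> y - \<phi> x)"
      if "x \<in> {0..2*pi}" for x
    proof (intro exI conjI allI impI)
      fix y assume y: "y \<in> {0..2*pi} \<and> \<phi> y \<noteq> \<phi> x"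
      have "exp (\<phi> y) = exp (\<phi> x)"
        using exp\<phi> by simp
      then obtain k :: int where k: "\<phi> y = \<phi> x + (of_int (2 * k) * pi) * \<i>"
        using exp_eq by blast
      then have "\<phi> y - \<phi> x = of_int (2 * k) * of_real pi * \<i>" "k \<noteq> 0"
        using y by auto
      moreover have "1 \<le> \<bar>real_of_int k\<bar>"
        using \<open>k \<noteq> 0\<close> by linarith
      ultimately show "2 * pi \<le> norm (\<phi> y - \<phi> x)"
        by (simp add: norm_mult)
    qed auto
  qed auto
  then have "\<phi> 0 = \<phi> (2*pi)"
    unfolding constant_on_def by force
  then show ?thesis
    by (simp add: \<phi>_def \<gamma>_def)
qed

text \<open>Extend the logarithm into \<open>U\<close> by Tietze's theorem and divide out the remaining factors, which
  do not vanish on the closure of \<open>U\<close>. Continued by \<open>(x - p k) powi m k\<close> outside \<open>U\<close>, this gives a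
  nowhere vanishing function on the plane, so \<open>(x - p k) powi m k\<close> has a logarithm on a large circle.\<close>

lemma product_log_imp_exponent_zero:
  fixes X :: "complex set" and p :: "'i \<Rightarrow> complex" and m :: "'i \<Rightarrow> int"
  assumes "closed X" "finite I" "k \<in> I"
    and U: "U \<in> components (- X)" "bounded U" "p k \<in> U"
    and p: "\<And>i. i \<in> I - {k} \<Longrightarrow> p i \<notin> U \<union> X"
    and L: "continuous_on X L" "\<And>x. x \<in> X \<Longrightarrow> exp (L x) = (\<Prod>i\<in>I. (x - p i) powi m i)"
  shows "m k = 0"
proof -
  have "open U"
    using U \<open>closed X\<close> open_components open_Compl by blast
  have fr: "frontier U \<subseteq> X"
    using U \<open>closed X\<close> frontier_of_components_closed_complement by blast
  obtain L' where L': "continuous_on UNIV L'" "\<And>x. x \<in> X \<Longrightarrow> L' x = L x"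
    using Tietze_unbounded[OF L(1), of UNIV] \<open>closed X\<close> by auto
  define h where "h x = (\<Prod>i\<in>I - {k}. (x - p i) powi m i)" for x
  have clU: "closure U \<subseteq> U \<union> X"
    using fr closure_Un_frontier[of U] by auto
  have hnz: "h x \<noteq> 0" if "x \<in> closure U" for x
    using that p clU \<open>finite I\<close> unfolding h_def by auto
  have split: "(\<Prod>i\<in>I. (x - p i) powi m i) = (x - p k) powi m k * h x" for x
    using \<open>finite I\<close> \<open>k \<in> I\<close> by (simp add: h_def prod.remove)
  define Q where "Q x = (if x \<in> closure U then exp (L' x) / h x else (x - p k) powi m k)" for x
  have "continuous_on (closure U \<union> - U) Q"
    unfolding Q_def
  proof (rule continuous_on_If)
    have "continuous_on (closure U) h"
      unfolding h_def using p clU by (intro continuous_intros) auto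
    then show "continuous_on (closure U) (\<lambda>x. exp (L' x) / h x)"
      using L'(1) hnz by (intro continuous_intros) (auto intro: continuous_on_subset)
    show "continuous_on (- U) (\<lambda>x. (x - p k) powi m k)"
      using U(3) by (intro continuous_intros) auto
    \<comment> \<open>The two pieces overlap in the frontier of \<open>U\<close>, which lies in
      \<open>X\<close>. There the exponential of \<open>L'\<close> is the full product, and dividing
      by \<open>h\<close> leaves the factor of \<open>k\<close>.\<close>
    show "exp (L' x) / h x = (x - p k) powi m k" if "x \<in> - U" "x \<in> closure U" for x
    proof -
      have "x \<in> X"
        using that clU by auto
      then show ?thesis
        using L L' split hnz that by (simp add: field_simps)
    qed
  qed (use \<open>open U\<close> in auto)
  moreover have "closure U \<union> - U = UNIV"
    using closure_subset by auto
  ultimately have "continuous_on UNIV Q"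
    by simp
  moreover have "Q x \<noteq> 0" for x
    using hnz U(3) closure_subset[of U] by (auto simp: Q_def)
  ultimately obtain M where M: "continuous_on UNIV M" "\<And>x. Q x = exp (M x)"
    using continuous_logarithm_on_contractible[of UNIV Q] contractible_UNIV by auto
  obtain R where R: "R > 0" "closure U \<subseteq> ball (p k) R"
    using bounded_subset_ballD[of "closure U" "p k"] U(2) by auto
  show ?thesis
  proof (rule power_int_log_on_sphere_imp_zero)
    show "continuous_on (sphere (p k) R) M"
      using M(1) continuous_on_subset by blast
    show "exp (M x) = (x - p k) powi m k" if "x \<in> sphere (p k) R" for x
    proof -
      have "x \<notin> closure U"
        using that R(2) by auto
      then show ?thesis
        by (simp add: M(2)[symmetric] Q_def)
    qed
  qed (rule R)
qed


text \<open>With one more component than arcs, the integer defects of the logarithms along the arcs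
  form more vectors than coordinates. A linear dependence cancels the defects, so the corresponding
  product of powers has a continuous logarithm on the whole union; every exponent must then
  vanish.\<close>

lemma card_bounded_components_arcs:
  fixes P :: "complex set" and \<A> :: "complex set set"
  assumes P: "finite P" and \<A>: "finite \<A>"
    and arcs: "\<And>A. A \<in> \<A> \<Longrightarrow> \<exists>g. arc g \<and> path_image g = A \<and> A \<inter> P \<subseteq> {pathstart g, pathfinish g}"
    and disj: "\<And>A B. A \<in> \<A> \<Longrightarrow> B \<in> \<A> \<Longrightarrow> A \<noteq> B \<Longrightarrow> A \<inter> B \<subseteq> P"
  shows "finite {U \<in> components (- (P \<union> \<Union>\<A>)). bounded U}
    \<and> card {U \<in> components (- (P \<union> \<Union>\<A>)). bounded U} \<le> card \<A>"
proof (rule ccontr)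
  define X where "X = P \<union> \<Union>\<A>"
  define \<U> where "\<U> = {U \<in> components (- X). bounded U}"
  assume "\<not> ?thesis"
  then have "\<not> (finite \<U> \<and> card \<U> \<le> card \<A>)"
    by (simp add: \<U>_def X_def)
  then obtain I where I: "I \<subseteq> \<U>" "finite I" "card I = Suc (card \<A>)"
    by (metis Suc_leI infinite_arbitrarily_large not_le obtain_subset_with_card_n)
  obtain g where g: "\<And>A. A \<in> \<A> \<Longrightarrow> arc (g A)" "\<And>A. A \<in> \<A> \<Longrightarrow> path_image (g A) = A"
    "\<And>A. A \<in> \<A> \<Longrightarrow> A \<inter> P \<subseteq> {pathstart (g A), pathfinish (g A)}"
    using arcs by metis
  have clA: "closed A" if "A \<in> \<A>" for A
    using g[OF that] closed_arc_image by metis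
  then have "closed X"
    unfolding X_def using P \<A> by (intro closed_Un closed_Union) (auto simp: finite_imp_closed)
  define q :: "complex set \<Rightarrow> complex" where "q U = (SOME x. x \<in> U)" for U
  have q: "q U \<in> U" if "U \<in> I" for U
    using that I(1) in_components_nonempty[of U "- X"] unfolding \<U>_def q_def by (auto simp: some_in_eq)
  have qX: "q U \<notin> X" if "U \<in> I" for U
    using q[OF that] that I(1) in_components_subset unfolding \<U>_def by blast
  \<comment> \<open>The principal value \<open>Ln\<close> only fixes one common choice of logarithm
    at each end of an arc, so its discontinuity is harmless. The logarithm on \<open>A\<close> is
    normalised at the start, and \<open>n\<close> is its defect at the finish in units of 2 \<pi>
    \<i>.\<close>
  define is_log where "is_log A U l n \<longleftrightarrow> continuous_on A l \<and> (\<forall>x\<in>A. exp (l x) = x - q U) \<and>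
      l (pathstart (g A)) = Ln (pathstart (g A) - q U) \<and>
      l (pathfinish (g A)) = Ln (pathfinish (g A) - q U) + of_int (2 * n) * of_real pi * \<i>"
    for A U l and n :: int
  have "\<exists>l n. is_log A U l n"
    if A: "A \<in> \<A>" and U: "U \<in> I" for A U
  proof -
    have "contractible A"
      using homeomorphic_arc_image_interval[OF g(1)[OF A], of 0 "1::real"] g(2)[OF A]
      by (metis convex_imp_contractible convex_real_interval(5) homeomorphic_contractible_eq zero_less_one)
    moreover have nz: "x - q U \<noteq> 0" if "x \<in> A" for x
      using qX[OF U] that A by (auto simp: X_def)
    moreover have "continuous_on A (\<lambda>x. x - q U)"
      by (intro continuous_intros)
    ultimately obtain l where l: "continuous_on A l" "\<And>x. x \<in> A \<Longrightarrow> x - q U = exp (l x)"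
      using continuous_logarithm_on_contractible[of A "\<lambda>x. x - q U"] by metis
    define s where "s = pathstart (g A)"
    define f where "f = pathfinish (g A)"
    have sf: "s \<in> A" "f \<in> A"
      using g(2)[OF A] by (auto simp: s_def f_def)
    define l' where "l' x = l x - l s + Ln (s - q U)" for x
    have l': "exp (l' x) = x - q U" if "x \<in> A" for x
      using l(2)[OF that] l(2)[OF sf(1)] nz[OF sf(1)] by (simp add: l'_def exp_add exp_diff)
    then have "exp (l' f) = exp (Ln (f - q U))"
      using sf nz by simp
    then obtain n :: int where "l' f = Ln (f - q U) + of_int (2 * n) * of_real pi * \<i>"
      using exp_eq by auto
    moreover have "continuous_on A l'"
      unfolding l'_def by (intro continuous_intros l)
    moreover have "l' s = Ln (s - q U)"
      by (simp add: l'_def)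
    ultimately show ?thesis
      using l' unfolding s_def f_def is_log_def by blast
  qed
  then obtain l n where "\<And>A U. A \<in> \<A> \<Longrightarrow> U \<in> I \<Longrightarrow> is_log A U (l A U) (n A U)"
    by metis
  then have l: "\<And>A U. A \<in> \<A> \<Longrightarrow> U \<in> I \<Longrightarrow> continuous_on A (l A U)"
    and lexp: "\<And>A U x. A \<in> \<A> \<Longrightarrow> U \<in> I \<Longrightarrow> x \<in> A \<Longrightarrow> exp (l A U x) = x - q U"
    and ls: "\<And>A U. A \<in> \<A> \<Longrightarrow> U \<in> I \<Longrightarrow> l A U (pathstart (g A)) = Ln (pathstart (g A) - q U)"
    and lf: "\<And>A U. A \<in> \<A> \<Longrightarrow> U \<in> I \<Longrightarrow>
      l A U (pathfinish (g A)) = Ln (pathfinish (g A) - q U) + of_int (2 * n A U) * of_real pi * \<i>"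
    unfolding is_log_def by blast+
  obtain m where m: "\<exists>U\<in>I. m U \<noteq> 0" "\<And>A. A \<in> \<A> \<Longrightarrow> (\<Sum>U\<in>I. m U * n A U) = 0"
    using int_vectors_dependent[OF \<A> I(2), of "\<lambda>U A. n A U"] I(3) by auto
  \<comment> \<open>Off \<open>P\<close> the arc through \<open>x\<close> is unique, because
    distinct arcs meet only in \<open>P\<close>; the choice by \<open>SOME\<close> is therefore
    determined.\<close>
  define L where "L x = (if x \<in> P then (\<Sum>U\<in>I. of_int (m U) * Ln (x - q U))
      else (\<Sum>U\<in>I. of_int (m U) * l (SOME A. A \<in> \<A> \<and> x \<in> A) U x))" for x
  \<comment> \<open>A point of \<open>P\<close> on \<open>A\<close> is an end of the arc. At the
    start both formulas agree; at the finish they differ by a multiple of the sum of the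
    \<open>m U * n A U\<close>, which is zero by the choice of \<open>m\<close>.\<close>
  have LA: "L x = (\<Sum>U\<in>I. of_int (m U) * l A U x)" if A: "A \<in> \<A>" "x \<in> A" for A x
  proof (cases "x \<in> P")
    case False
    have "(SOME A. A \<in> \<A> \<and> x \<in> A) = A"
      using False A disj by (intro some_equality) blast+
    with False show ?thesis
      by (simp add: L_def)
  next
    case True
    then consider "x = pathstart (g A)" | "x = pathfinish (g A)"
      using g(3)[OF A(1)] A by blast
    then show ?thesis
    proof cases
      case 1
      then show ?thesis
        using True A ls by (simp add: L_def)
    next
      case 2
      have "(\<Sum>U\<in>I. of_int (m U) * l A U x) = (\<Sum>U\<in>I. of_int (m U) * Ln (x - q U)
          + of_int (m U * n A U) * (2 * of_real pi * \<i>))"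
        using 2 lf[OF A(1)] by (intro sum.cong) (auto simp: algebra_simps)
      also have "\<dots> = (\<Sum>U\<in>I. of_int (m U) * Ln (x - q U))
          + of_int (\<Sum>U\<in>I. m U * n A U) * (2 * of_real pi * \<i>)"
        by (simp only: sum.distrib of_int_sum sum_distrib_right)
      finally show ?thesis
        using True m(2)[OF A(1)] by (simp add: L_def)
    qed
  qed
  have "continuous_on (\<Union>A\<in>\<A>. A) L"
  proof (rule continuous_on_closed_Union[OF \<A>])
    show "continuous_on A L" if "A \<in> \<A>" for A
      using that LA by (subst continuous_on_cong[OF refl LA]) (auto intro!: continuous_intros l)
  qed (rule clA)
  then have "continuous_on (P \<union> \<Union>\<A>) L"
    using P \<A> clA by (intro continuous_on_closed_Un) (auto simp: finite_imp_closed continuous_on_finite)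
  then have Lcont: "continuous_on X L"
    by (simp add: X_def)
  have Lexp: "exp (L x) = (\<Prod>U\<in>I. (x - q U) powi m U)" if x: "x \<in> X" for x
  proof -
    have "\<exists>y. L x = (\<Sum>U\<in>I. of_int (m U) * y U) \<and> (\<forall>U\<in>I. exp (y U) = x - q U)"
    proof (cases "x \<in> P")
      case True
      have "exp (Ln (x - q U)) = x - q U" if "U \<in> I" for U
        using qX[OF that] x by (intro exp_Ln) auto
      then show ?thesis
        using True by (intro exI[of _ "\<lambda>U. Ln (x - q U)"]) (simp add: L_def)
    next
      case False
      then obtain A where "A \<in> \<A>" "x \<in> A"
        using x by (auto simp: X_def)
      then show ?thesis
        using LA lexp by (intro exI[of _ "\<lambda>U. l A U x"]) simp
    qed
    then obtain y where y: "L x = (\<Sum>U\<in>I. of_int (m U) * y U)" "\<And>U. U \<in> I \<Longrightarrow> exp (y U) = x - q U"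
      by blast
    then show ?thesis
      using \<open>finite I\<close> by (simp add: exp_sum exp_power_int[symmetric])
  qed
  have "m U = 0" if U: "U \<in> I" for U
  proof (rule product_log_imp_exponent_zero[OF \<open>closed X\<close> I(2) U _ _ q[OF U] _ Lcont Lexp])
    show "U \<in> components (- X)" "bounded U"
      using U I(1) by (auto simp: \<U>_def)
    show "q W \<notin> U \<union> X" if W: "W \<in> I - {U}" for W
      using W U I(1) q[of W] qX[of W] components_nonoverlap[of U "- X" W] by (auto simp: \<U>_def)
  qed
  with m(1) show False
    by blast
qed

section \<open>Closed walks in hyperbolic graphs\<close>

text \<open>Equality of these sums for all antisymmetric weights stands in for equality of 1-chains;
  the weight used later is the winding number of an edge.\<close>

fun walk_weight :: "('v \<Rightarrow> 'v \<Rightarrow> 'a::ab_group_add) \<Rightarrow> 'v list \<Rightarrow> 'a" where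
  "walk_weight w (x # y # xs) = w x y + walk_weight w (y # xs)"
| "walk_weight w _ = 0"

text \<open>Walks are concatenated as \<open>xs @ tl ys\<close>, so that the common vertex is listed
  once and the edges are exactly those of the two walks.\<close>

lemma walk_weight_join:
  "xs \<noteq> [] \<Longrightarrow> ys \<noteq> [] \<Longrightarrow> last xs = hd ys \<Longrightarrow>
    walk_weight w (xs @ tl ys) = walk_weight w xs + walk_weight w ys"
proof (induction w xs rule: walk_weight.induct)
  case ("2_2" w x)
  then show ?case
    by (cases ys) auto
qed (auto simp: add.assoc)

lemma walk_Nil [simp]: "\<not> walk V E []"
  by (simp add: walk_def)

lemma walk_singleton [simp]: "walk V E [x] \<longleftrightarrow> x \<in> V"
  by (simp add: walk_def)

lemma walk_Cons [simp]: "walk V E (x # y # xs) \<longleftrightarrow> x \<in> V \<and> E x y \<and> walk V E (y # xs)"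
  unfolding walk_def by (auto simp: nth_Cons split: nat.splits)

lemma walk_not_Nil: "walk V E xs \<Longrightarrow> xs \<noteq> []"
  by auto

lemma walk_take: "walk V E xs \<Longrightarrow> 0 < n \<Longrightarrow> walk V E (take n xs)"
  unfolding walk_def by (auto dest: in_set_takeD)

lemma walk_drop: "walk V E xs \<Longrightarrow> n < length xs \<Longrightarrow> walk V E (drop n xs)"
  unfolding walk_def by (auto dest: in_set_dropD)

lemma walk_join:
  assumes "walk V E xs" "walk V E ys" "last xs = hd ys"
  shows "walk V E (xs @ tl ys)"
  using assms
proof (induction xs rule: induct_list012)
  case (2 x)
  then show ?case
    by (cases ys) auto
qed auto

lemma last_join: "ys \<noteq> [] \<Longrightarrow> last xs = hd ys \<Longrightarrow> last (xs @ tl ys) = last ys"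
  by (cases ys) (auto simp: last_append)

text \<open>Both end indices are included, so the part from \<open>i\<close> to \<open>j\<close> has
  \<open>j - i\<close> edges.\<close>

definition subwalk :: "'v list \<Rightarrow> nat \<Rightarrow> nat \<Rightarrow> 'v list" where
  "subwalk W i j = drop i (take (Suc j) W)"

lemma subwalk:
  assumes "walk V E W" "i \<le> j" "j < length W"
  shows "walk V E (subwalk W i j)" "hd (subwalk W i j) = W ! i" "last (subwalk W i j) = W ! j"
    "length (subwalk W i j) = Suc (j - i)"
  using assms
  by (auto simp: subwalk_def hd_drop_conv_nth last_conv_nth intro!: walk_take walk_drop)

lemma nth_in_subwalk: "i \<le> k \<Longrightarrow> k \<le> j \<Longrightarrow> j < length W \<Longrightarrow> W ! k \<in> set (subwalk W i j)"
  unfolding subwalk_def in_set_conv_nth by (intro exI[of _ "k - i"]) auto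

lemma subwalk_join:
  assumes "i \<le> j" "j \<le> k" "k < length W"
  shows "subwalk W i j @ tl (subwalk W j k) = subwalk W i k"
proof (rule nth_equalityI)
  fix n assume "n < length (subwalk W i j @ tl (subwalk W j k))"
  moreover have "Suc (n + i - Suc 0) = i + n" if "\<not> n < Suc j - i"
    using that assms by linarith
  ultimately show "(subwalk W i j @ tl (subwalk W j k)) ! n = subwalk W i k ! n"
    using assms by (auto simp: subwalk_def nth_append nth_tl min_def)
qed (use assms in \<open>auto simp: subwalk_def\<close>)

section \<open>Distances and geodesics\<close>

text \<open>\<open>gdist\<close> is a least element and carries information only if some walk
  exists; the triangle inequality is stated under this condition.\<close>

definition joined :: "'v set \<Rightarrow> ('v \<Rightarrow> 'v \<Rightarrow> bool) \<Rightarrow> 'v \<Rightarrow> 'v \<Rightarrow> bool" where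
  "joined V E u v \<longleftrightarrow> (\<exists>xs. walk V E xs \<and> hd xs = u \<and> last xs = v)"

lemma gdist_le_walk: "walk V E xs \<Longrightarrow> length xs = Suc n \<Longrightarrow> gdist V E (hd xs) (last xs) \<le> n"
  unfolding gdist_def by (rule Least_le) blast

lemma joined_imp_geodesic: "joined V E u v \<Longrightarrow> \<exists>xs. geodesic V E xs u v"
proof -
  assume "joined V E u v"
  then obtain xs where xs: "walk V E xs" "hd xs = u" "last xs = v"
    unfolding joined_def by blast
  then have "\<exists>xs'. walk V E xs' \<and> hd xs' = u \<and> last xs' = v \<and> length xs' = Suc (length xs - 1)"
    by (intro exI[of _ xs]) (auto dest: walk_not_Nil)
  from LeastI[where P = "\<lambda>n. \<exists>xs. walk V E xs \<and> hd xs = u \<and> last xs = v \<and> length xs = Suc n", OF this]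
  show ?thesis
    unfolding geodesic_def gdist_def by blast
qed

lemma joined_trans: "joined V E u v \<Longrightarrow> joined V E v x \<Longrightarrow> joined V E u x"
  unfolding joined_def by (metis walk_join last_join hd_append2 walk_not_Nil)

lemma gdist_triangle:
  assumes "joined V E u v" "joined V E v x"
  shows "gdist V E u x \<le> gdist V E u v + gdist V E v x"
proof -
  obtain xs ys where "geodesic V E xs u v" "geodesic V E ys v x"
    using assms joined_imp_geodesic by meson
  then have xy: "walk V E xs" "walk V E ys" "hd xs = u" "last xs = v" "hd ys = v" "last ys = x"
    "length xs = Suc (gdist V E u v)" "length ys = Suc (gdist V E v x)"
    by (auto simp: geodesic_def)
  then have "hd (xs @ tl ys) = u" "last (xs @ tl ys) = x"
    using last_join[of ys xs] by (auto dest!: walk_not_Nil)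
  then show ?thesis
    using gdist_le_walk[OF walk_join, of V E xs ys] xy by simp
qed

text \<open>Cutting the geodesic at \<open>x\<close> yields two walks whose lengths add up to its
  own. This is the converse of the triangle inequality for points on a geodesic.\<close>

lemma geodesic_split:
  assumes "geodesic V E xs u v" "x \<in> set xs"
  shows "joined V E u x" "joined V E x v" "gdist V E u x + gdist V E x v \<le> gdist V E u v"
proof -
  have xs: "walk V E xs" "hd xs = u" "last xs = v" "length xs = Suc (gdist V E u v)"
    using assms by (auto simp: geodesic_def)
  obtain k where k: "k < length xs" "xs ! k = x"
    using assms(2) by (auto simp: in_set_conv_nth)
  have "xs ! 0 = u" "xs ! (length xs - 1) = v"
    using xs walk_not_Nil by (metis hd_conv_nth, metis last_conv_nth)
  then have 1: "walk V E (subwalk xs 0 k)" "hd (subwalk xs 0 k) = u" "last (subwalk xs 0 k) = x"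
    "length (subwalk xs 0 k) = Suc k"
    and 2: "walk V E (subwalk xs k (length xs - 1))" "hd (subwalk xs k (length xs - 1)) = x"
    "last (subwalk xs k (length xs - 1)) = v"
    "length (subwalk xs k (length xs - 1)) = Suc (length xs - 1 - k)"
    using subwalk[OF xs(1), of 0 k] subwalk[OF xs(1), of k "length xs - 1"] k by auto
  then show "joined V E u x" "joined V E x v"
    unfolding joined_def by blast+
  show "gdist V E u x + gdist V E x v \<le> gdist V E u v"
    using gdist_le_walk[OF 1(1,4)] gdist_le_walk[OF 2(1,4)] 1 2 k xs(4) by simp
qed

lemma walk_rev:
  assumes "simple_graph V E" "walk V E xs"
  shows "walk V E (rev xs)"
  unfolding walk_def
proof (intro conjI allI impI)
  fix i assume i: "Suc i < length (rev xs)"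
  then have "E (xs ! (length xs - Suc (Suc i))) (xs ! Suc (length xs - Suc (Suc i)))"
    using assms(2) unfolding walk_def by simp
  moreover have "Suc (length xs - Suc (Suc i)) = length xs - Suc i"
    using i by simp
  ultimately show "E (rev xs ! i) (rev xs ! Suc i)"
    using assms(1) i unfolding simple_graph_def by (simp add: rev_nth)
qed (use assms(2) in \<open>auto simp: walk_def\<close>)

lemma joined_sym: "simple_graph V E \<Longrightarrow> joined V E u v \<Longrightarrow> joined V E v u"
  unfolding joined_def by (metis walk_rev hd_rev last_rev)

lemma gdist_commute:
  assumes "simple_graph V E"
  shows "gdist V E u v = gdist V E v u"
proof -
  have "(\<exists>xs. walk V E xs \<and> hd xs = u \<and> last xs = v \<and> length xs = Suc n) \<longleftrightarrow>
    (\<exists>xs. walk V E xs \<and> hd xs = v \<and> last xs = u \<and> length xs = Suc n)" for n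
    by (metis assms walk_rev hd_rev last_rev length_rev)
  then show ?thesis
    by (simp add: gdist_def)
qed

lemma walk_weight_rev:
  assumes "\<And>u v. E u v \<Longrightarrow> w v u = - w u v" "walk V E xs"
  shows "walk_weight w (rev xs) = - walk_weight w xs"
  using assms(2)
proof (induction xs rule: induct_list012)
  case (3 x y zs)
  have "walk_weight w (rev (x # y # zs)) = walk_weight w (rev (y # zs) @ tl [y, x])"
    by simp
  also have "\<dots> = walk_weight w (rev (y # zs)) + w y x"
    by (subst walk_weight_join) auto
  finally show ?case
    using 3 assms(1) by simp
qed auto

section \<open>Thin triangles and Dehn's algorithm\<close>

text \<open>Distances are natural numbers, so the real constant of hyperbolicity can be rounded
  down. \<open>Q\<close> is the side opposite to \<open>x\<close>, which will be the base point of a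
  closed walk.\<close>

definition thin_triangles :: "'v set \<Rightarrow> ('v \<Rightarrow> 'v \<Rightarrow> bool) \<Rightarrow> nat \<Rightarrow> bool" where
  "thin_triangles V E \<delta> \<longleftrightarrow> (\<forall>x y z P Q R.
     geodesic V E P x y \<longrightarrow> geodesic V E Q y z \<longrightarrow> geodesic V E R x z \<longrightarrow>
     (\<forall>q\<in>set Q. \<exists>r\<in>set P \<union> set R. gdist V E q r \<le> \<delta>))"

lemma hyperbolic_graph_thin_triangles:
  assumes "hyperbolic_graph V E"
  obtains \<delta> where "thin_triangles V E \<delta>"
proof -
  obtain \<delta> :: real where \<delta>: "\<forall>x y z P Q R.
      geodesic V E P x y \<longrightarrow> geodesic V E Q y z \<longrightarrow> geodesic V E R x z \<longrightarrow> near_union V E \<delta> Q P R"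
    using assms unfolding hyperbolic_graph_def by blast
  have "thin_triangles V E (nat \<lfloor>\<delta>\<rfloor>)"
    unfolding thin_triangles_def
  proof (intro allI impI ballI)
    fix x y z P Q R q
    assume "geodesic V E P x y" "geodesic V E Q y z" "geodesic V E R x z" "q \<in> set Q"
    then obtain r where "r \<in> set P \<union> set R" "real (gdist V E q r) \<le> \<delta>"
      using \<delta> unfolding near_union_def by blast
    then show "\<exists>r\<in>set P \<union> set R. gdist V E q r \<le> nat \<lfloor>\<delta>\<rfloor>"
      by (intro bexI[of _ r]) (auto simp: le_nat_floor)
  qed
  then show thesis
    using that by blast
qed

text \<open>Compare a vertex of the closed walk furthest from its base point with the vertices
  \<open>2\<delta> + 1\<close> steps before and after it.\<close>

lemma hyperbolic_closed_walk_shortcut: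
  assumes G: "simple_graph V E"
    and thin: "thin_triangles V E \<delta>"
    and W: "walk V E W" "hd W = last W" "length W = Suc n" and m: "m = 2 * \<delta> + 1" "m \<le> n"
  shows "\<exists>i j. i < j \<and> j \<le> n \<and> j - i \<le> 2 * m \<and> gdist V E (W ! i) (W ! j) < j - i"
proof (rule ccontr)
  assume neg: "\<not> ?thesis"
  let ?d = "gdist V E"
  have le: "?d (W ! i) (W ! j) \<le> j - i" if "i \<le> j" "j \<le> n" for i j
    using subwalk[OF W(1), of i j] that W(3) gdist_le_walk[of V E "subwalk W i j" "j - i"] by simp
  \<comment> \<open>By the negated claim every stretch of at most \<open>2 * m\<close> edges is
    geodesic.\<close>
  then have geo: "?d (W ! i) (W ! j) = j - i" if "i < j" "j \<le> n" "j - i \<le> 2 * m" for i j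
    using neg that by (metis le_antisym not_less less_imp_le)
  have "joined V E (W ! i) (W ! j)" if "i \<le> j" "j \<le> n" for i j
    using subwalk[OF W(1), of i j] that W(3) unfolding joined_def by (metis le_imp_less_Suc)
  then have J: "joined V E (W ! i) (W ! j)" if "i \<le> n" "j \<le> n" for i j
    using that joined_sym[OF G] by (metis nat_le_linear)
  define a where "a = W ! 0"
  have a: "W ! n = a"
    using W hd_conv_nth[of W] last_conv_nth[of W] unfolding a_def by force
  obtain i where i: "i \<le> n" "\<And>j. j \<le> n \<Longrightarrow> ?d a (W ! j) \<le> ?d a (W ! i)"
  proof -
    have "Max ((\<lambda>j. ?d a (W ! j)) ` {..n}) \<in> (\<lambda>j. ?d a (W ! j)) ` {..n}"
      by (rule Max_in) auto
    then obtain i where "i \<le> n" "Max ((\<lambda>j. ?d a (W ! j)) ` {..n}) = ?d a (W ! i)"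
      by (metis (no_types, lifting) atMost_iff imageE)
    then show thesis
      using that Max_ge[of "(\<lambda>j. ?d a (W ! j)) ` {..n}"] by fastforce
  qed
  \<comment> \<open>The vertex after \<open>m\<close> steps is already at distance \<open>m\<close>,
    so the furthest one is at least that far from \<open>a\<close> along the walk in both
    directions. Hence \<open>i - m\<close> and \<open>i + m\<close> are valid indices, without
    wrapping around.\<close>
  have "?d a (W ! m) = m"
    using geo[of 0 m] m unfolding a_def by simp
  then have "m \<le> ?d a (W ! i)"
    using i(2)[of m] m by simp
  moreover have "?d a (W ! i) \<le> i" "?d a (W ! i) \<le> n - i"
    using le[of 0 i] le[of i n] i gdist_commute[OF G] a unfolding a_def by auto
  ultimately have im: "m \<le> i" "i + m \<le> n"
    using i(1) by linarith+
  define Q where "Q = subwalk W (i - m) (i + m)"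
  have Q: "geodesic V E Q (W ! (i - m)) (W ! (i + m))"
    using subwalk[OF W(1), of "i - m" "i + m"] geo[of "i - m" "i + m"] im m W(3)
    unfolding geodesic_def Q_def by auto
  obtain P R where PR: "geodesic V E P a (W ! (i - m))" "geodesic V E R a (W ! (i + m))"
    using joined_imp_geodesic J im unfolding a_def by (metis diff_le_self i(1) le_trans zero_le)
  have "W ! i \<in> set Q"
    unfolding Q_def using im W(3) by (intro nth_in_subwalk) auto
  then obtain r where r: "r \<in> set P \<union> set R" "?d (W ! i) r \<le> \<delta>"
    using thin PR Q unfolding thin_triangles_def by blast
  \<comment> \<open>Let \<open>r\<close> lie on the side from \<open>a\<close> to
    \<open>W ! k\<close>. As \<open>r\<close> is within \<delta> of \<open>W ! i\<close>, it is at
    least m - \<delta> = \<delta> + 1 away from \<open>W ! k\<close>. So \<open>W ! k\<close> is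
    further from \<open>a\<close> than \<open>W ! i\<close>, against the choice of
    \<open>i\<close>.\<close>
  have no: False if k: "k \<le> n" "?d (W ! k) (W ! i) = m" and S: "geodesic V E S a (W ! k)" "r \<in> set S" for k S
  proof -
    note sp = geodesic_split[OF S]
    have "joined V E r (W ! i)"
      using joined_trans[OF sp(2) J[OF k(1) i(1)]] .
    then have "?d a (W ! i) \<le> ?d a r + ?d r (W ! i)" "?d (W ! k) (W ! i) \<le> ?d (W ! k) r + ?d r (W ! i)"
      using gdist_triangle sp joined_sym[OF G] by metis+
    moreover have "?d a (W ! k) \<le> ?d a (W ! i)"
      using i(2) k by simp
    ultimately show False
      using sp(3) r(2) k(2) m gdist_commute[OF G, of "W ! k" r] gdist_commute[OF G, of "W ! i" r] by linarith
  qed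
  have "i - m \<le> n" "gdist V E (W ! (i - m)) (W ! i) = m" "gdist V E (W ! (i + m)) (W ! i) = m"
    using im i(1) m(1) geo[of "i - m" i] geo[of i "i + m"] gdist_commute[OF G, of "W ! (i + m)"] by auto
  then show False
    using r(1) no[OF _ _ PR(1)] no[OF _ _ PR(2)] im by blast
qed

text \<open>Dehn's algorithm: a long closed walk contains a short non-geodesic subwalk; replacing it by a
  geodesic shortens the walk and splits off one short closed walk.\<close>

lemma hyperbolic_closed_walk_decomposition:
  fixes V :: "'v set"
  assumes G: "simple_graph V E"
    and thin: "thin_triangles V E \<delta>"
    and m: "m = 2 * \<delta> + 1"
    and "walk V E W" "hd W = last W" "length W = Suc n"
  shows "\<exists>Ls. length Ls \<le> n \<and> (\<forall>L\<in>set Ls. walk V E L \<and> hd L = last L \<and> length L \<le> 4 * m) \<and>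
    (\<forall>w :: 'v \<Rightarrow> 'v \<Rightarrow> 'a::ab_group_add. (\<forall>u v. E u v \<longrightarrow> w v u = - w u v) \<longrightarrow>
       walk_weight w W = (\<Sum>L\<leftarrow>Ls. walk_weight w L))"
  using assms(4-)
proof (induction n arbitrary: W rule: less_induct)
  case (less n W)
  consider "n = 0" | "0 < n" "n < m" | "m \<le> n"
    by linarith
  then show ?case
  proof cases
    case 1
    then obtain x where "W = [x]"
      using less.prems(3) by (auto simp: length_Suc_conv)
    then show ?thesis
      by (intro exI[of _ "[]"]) auto
  next
    case 2
    then show ?thesis
      \<comment> \<open>The walk is itself short; having at least one edge, it may count as one
        piece.\<close>
      using less.prems by (intro exI[of _ "[W]"]) auto
  next
    case 3
    note W = less.prems
    obtain i j where ij: "i < j" "j \<le> n" "j - i \<le> 2 * m" "gdist V E (W ! i) (W ! j) < j - i"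
      using hyperbolic_closed_walk_shortcut[OF G thin W m 3] by blast
    define A B C where "A = subwalk W 0 i" and "B = subwalk W i j" and "C = subwalk W j n"
    have A: "walk V E A" "hd A = W ! 0" "last A = W ! i" "length A = Suc i"
      using subwalk[OF W(1), of 0 i] ij W(3) unfolding A_def by simp_all
    have B: "walk V E B" "hd B = W ! i" "last B = W ! j" "length B = Suc (j - i)"
      using subwalk[OF W(1), of i j] ij W(3) unfolding B_def by simp_all
    have C: "walk V E C" "hd C = W ! j" "last C = W ! n" "length C = Suc (n - j)"
      using subwalk[OF W(1), of j n] ij W(3) unfolding C_def by simp_all
    have "joined V E (W ! i) (W ! j)"
      using B unfolding joined_def by blast
    from joined_imp_geodesic[OF this] obtain \<Gamma> where "geodesic V E \<Gamma> (W ! i) (W ! j)" ..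
    then have \<Gamma>: "walk V E \<Gamma>" "hd \<Gamma> = W ! i" "last \<Gamma> = W ! j" "length \<Gamma> = Suc (gdist V E (W ! i) (W ! j))"
      by (auto simp: geodesic_def)
    have ne: "A \<noteq> []" "B \<noteq> []" "C \<noteq> []" "\<Gamma> \<noteq> []"
      using A B C \<Gamma> by auto
    have W0n: "W ! 0 = W ! n"
      using W hd_conv_nth[of W] last_conv_nth[of W] by force
    have Weq: "W = A @ tl (B @ tl C)"
      using ij W(3) by (simp add: A_def B_def C_def subwalk_join) (simp add: subwalk_def)
    \<comment> \<open>\<open>W'\<close> takes the geodesic in place of the detour \<open>B\<close>,
      and \<open>L\<close> runs along \<open>B\<close> and back along the geodesic. The weight of
      \<open>L\<close> is the difference of the weights of \<open>W\<close> and
      \<open>W'\<close>.\<close>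
    define W' where "W' = A @ tl (\<Gamma> @ tl C)"
    define L where "L = B @ tl (rev \<Gamma>)"
    have j\<Gamma>C: "walk V E (\<Gamma> @ tl C)" "last (\<Gamma> @ tl C) = W ! n" "hd (\<Gamma> @ tl C) = W ! i"
      using walk_join[OF \<Gamma>(1) C(1)] last_join[OF ne(3), of \<Gamma>] \<Gamma> C ne by auto
    have W': "walk V E W'" "hd W' = last W'"
      using walk_join[OF A(1) j\<Gamma>C(1)] last_join[of "\<Gamma> @ tl C" A] A j\<Gamma>C ne W0n unfolding W'_def by auto
    have r\<Gamma>: "walk V E (rev \<Gamma>)" "hd (rev \<Gamma>) = W ! j" "last (rev \<Gamma>) = W ! i" "rev \<Gamma> \<noteq> []"
      using walk_rev[OF G \<Gamma>(1)] \<Gamma> ne by (auto simp: hd_rev last_rev)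
    have L: "walk V E L" "hd L = last L"
      using walk_join[OF B(1) r\<Gamma>(1)] last_join[OF r\<Gamma>(4), of B] B r\<Gamma> ne unfolding L_def by auto
    \<comment> \<open>\<open>length\<close> counts vertices: \<open>B\<close> has at most
      \<open>2 * m + 1\<close>, and the way back adds at most \<open>2 * m - 1\<close> since the
      geodesic is strictly shorter.\<close>
    have lenL: "length L \<le> 4 * m"
      using B(4) \<Gamma>(4) ij unfolding L_def by simp
    \<comment> \<open>Each piece split off costs at least one edge, which bounds the number of
      pieces by \<open>n\<close>.\<close>
    have lenW': "length W' = Suc (length W' - 1)" "length W' - 1 < n"
      using A(4) C(4) \<Gamma>(4) ij ne unfolding W'_def by auto
    obtain Ls where Ls: "length Ls \<le> length W' - 1"
      "\<And>L. L \<in> set Ls \<Longrightarrow> walk V E L \<and> hd L = last L \<and> length L \<le> 4 * m"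
      "\<And>w :: 'v \<Rightarrow> 'v \<Rightarrow> 'a. (\<forall>u v. E u v \<longrightarrow> w v u = - w u v) \<Longrightarrow>
         walk_weight w W' = (\<Sum>L\<leftarrow>Ls. walk_weight w L)"
      using less.IH[OF lenW'(2) W' lenW'(1)] by blast
    show ?thesis
    proof (intro exI[of _ "L # Ls"] conjI allI impI)
      fix w :: "'v \<Rightarrow> 'v \<Rightarrow> 'a" assume w: "\<forall>u v. E u v \<longrightarrow> w v u = - w u v"
      have "walk_weight w W = walk_weight w A + (walk_weight w B + walk_weight w C)"
        using walk_weight_join[of A "B @ tl C" w] walk_weight_join[of B C w] A B C ne
        by (subst Weq) simp
      moreover have "walk_weight w W' = walk_weight w A + (walk_weight w \<Gamma> + walk_weight w C)"
        using walk_weight_join[of A "\<Gamma> @ tl C" w] walk_weight_join[of \<Gamma> C w] A \<Gamma> C ne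
        unfolding W'_def by simp
      moreover have "walk_weight w L = walk_weight w B - walk_weight w \<Gamma>"
        using B r\<Gamma> ne walk_weight_rev[of E w V \<Gamma>] w \<Gamma>(1) unfolding L_def by (simp add: walk_weight_join)
      ultimately show "walk_weight w W = (\<Sum>L\<leftarrow>L # Ls. walk_weight w L)"
        using Ls(3)[OF w] by (simp add: algebra_simps)
    qed (use Ls L lenL lenW' in auto)
  qed
qed

section \<open>Faces inside closed walks\<close>

lemma connected_subset_inside:
  assumes "connected T" "T \<inter> K = {}" "T \<inter> inside K \<noteq> {}"
  shows "T \<subseteq> inside K"
proof
  fix y assume "y \<in> T"
  obtain x where "x \<in> T" "x \<in> inside K"
    using assms by blast
  moreover have "connected_component (- K) x y"
    unfolding connected_component_def using assms \<open>x \<in> T\<close> \<open>y \<in> T\<close> by (intro exI[of _ T]) auto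
  ultimately show "y \<in> inside K"
    using inside_same_component by metis
qed

text \<open>By continuity the image of the open interval is dense in the arc. This later locates the
  ends of an edge from the position of its interior.\<close>

lemma arc_endpoints_in_closure:
  assumes "arc g"
  shows "path_image g \<subseteq> closure (path_image g - {pathstart g, pathfinish g})"
proof -
  have "g ` closure {0<..<1} \<subseteq> closure (g ` {0<..<1})"
    using arc_imp_path[OF assms] unfolding path_def by (intro continuous_image_closure_subset) auto
  then show ?thesis
    using simple_path_endless[OF arc_imp_simple_path[OF assms]] by (simp add: path_image_def)
qed

fun walk_image :: "('v \<Rightarrow> 'v \<Rightarrow> real \<Rightarrow> 'a::topological_space) \<Rightarrow> 'v list \<Rightarrow> 'a set" where
  "walk_image emb (x # y # xs) = path_image (emb x y) \<union> walk_image emb (y # xs)"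
| "walk_image emb _ = {}"

text \<open>A walk without edges has no path, hence the assumption \<open>2 \<le> length xs\<close>
  below. A single edge is its own base case, so no constant path is appended and arcs can stay
  arcs.\<close>

fun walk_path :: "('v \<Rightarrow> 'v \<Rightarrow> real \<Rightarrow> 'a::topological_space) \<Rightarrow> 'v list \<Rightarrow> real \<Rightarrow> 'a" where
  "walk_path emb (x # y # z # xs) = emb x y +++ walk_path emb (y # z # xs)"
| "walk_path emb [x, y] = emb x y"
| "walk_path emb _ = undefined"

lemma walk_image_append:
  "walk_image emb (xs @ [x]) = walk_image emb xs \<union> (if xs = [] then {} else path_image (emb (last xs) x))"
  by (induction xs rule: induct_list012) auto

lemma walk_image_conv_nth:
  "walk_image emb xs = (\<Union>i\<in>{i. Suc i < length xs}. path_image (emb (xs ! i) (xs ! Suc i)))"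
proof (induction xs rule: induct_list012)
  case (3 x y zs)
  have "{i. Suc i < length (x # y # zs)} = insert 0 (Suc ` {i. Suc i < length (y # zs)})"
    by (auto simp: image_iff less_Suc_eq_0_disj gr0_conv_Suc)
  then show ?case
    using 3(2) by simp
qed auto

text \<open>Repeating the first vertex at the end replaces indices modulo the length and turns a
  cycle into a closed walk.\<close>

lemma cycle_image_conv_walk_image:
  assumes "C \<noteq> []"
  shows "cycle_image emb C = walk_image emb (C @ [hd C])"
proof -
  have "(C @ [hd C]) ! Suc i = C ! ((i + 1) mod length C)" if "i < length C" for i
  proof (cases "Suc i = length C")
    case True
    then show ?thesis
      using assms by (simp add: nth_append hd_conv_nth)
  next
    case False
    then show ?thesis
      using that by (simp add: nth_append)
  qed
  then show ?thesis
    unfolding cycle_image_def walk_image_conv_nth by (auto simp: nth_append)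
qed

section \<open>Winding numbers in a plane drawing\<close>

text \<open>The drawing is placed in the complex plane, where winding numbers and logarithms are at
  hand; the final theorem transfers the result to \<open>real^2\<close>.\<close>

locale plane_drawing =
  fixes V :: "'v set" and E :: "'v \<Rightarrow> 'v \<Rightarrow> bool" and pos :: "'v \<Rightarrow> complex"
    and emb :: "'v \<Rightarrow> 'v \<Rightarrow> real \<Rightarrow> complex"
  assumes graph: "simple_graph V E"
    and inj_pos: "inj_on pos V"
    and arc_emb: "E u v \<Longrightarrow> arc (emb u v)"
    and pathstart_emb: "E u v \<Longrightarrow> pathstart (emb u v) = pos u"
    and pathfinish_emb: "E u v \<Longrightarrow> pathfinish (emb u v) = pos v"
    and image_emb_commute: "E u v \<Longrightarrow> path_image (emb v u) = path_image (emb u v)"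
    and image_emb_vertices: "E u v \<Longrightarrow> path_image (emb u v) \<inter> pos ` V \<subseteq> {pos u, pos v}"
    and image_emb_Int: "E u v \<Longrightarrow> E x y \<Longrightarrow> {u, v} \<noteq> {x, y} \<Longrightarrow>
      path_image (emb u v) \<inter> path_image (emb x y) \<subseteq> pos ` ({u, v} \<inter> {x, y})"
begin

lemma edge_in_V: "E u v \<Longrightarrow> u \<in> V" "E u v \<Longrightarrow> v \<in> V"
  using graph unfolding simple_graph_def by blast+

definition drawing :: "complex set" where
  "drawing = pos ` V \<union> \<Union>{path_image (emb u v) |u v. E u v}"

lemma image_emb_subset_drawing: "E u v \<Longrightarrow> path_image (emb u v) \<subseteq> drawing"
  unfolding drawing_def by blast

lemma path_emb: "E u v \<Longrightarrow> path (emb u v)"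
  using arc_emb arc_imp_path by blast

text \<open>The path is not closed, so this is a complex number and in general no integer. Only
  additivity under concatenation matters.\<close>

definition edge_winding :: "complex \<Rightarrow> 'v \<Rightarrow> 'v \<Rightarrow> complex" where
  "edge_winding p u v = winding_number (emb u v) p"

text \<open>\<open>emb v u\<close> has the same image as \<open>emb u v\<close> but need not be its
  reversal. Still, the two together form a loop within an arc; an arc has empty inside, so the loop
  has winding number zero about \<open>p\<close>.\<close>

lemma edge_winding_commute:
  assumes "E u v" "p \<notin> drawing"
  shows "edge_winding p v u = - edge_winding p u v"
proof -
  have "E v u"
    using assms graph unfolding simple_graph_def by blast
  note e = path_emb[OF assms(1)] path_emb[OF this]
    pathstart_emb[OF assms(1)] pathfinish_emb[OF assms(1)] pathstart_emb[OF this] pathfinish_emb[OF this]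
    image_emb_commute[OF assms(1)]
  have p: "p \<notin> path_image (emb u v)"
    using assms unfolding drawing_def by blast
  have "p \<in> outside (path_image (emb u v +++ emb v u))"
    using p e inside_arc_empty[OF arc_emb[OF assms(1)]] by (auto simp: path_image_join outside_inside)
  then have "winding_number (emb u v +++ emb v u) p = 0"
    using e by (intro winding_number_zero_in_outside) auto
  then have "edge_winding p u v + edge_winding p v u = 0"
    using e p unfolding edge_winding_def by (simp add: winding_number_join)
  then show ?thesis
    by (simp add: add_eq_0_iff)
qed

lemma walk_image_subset_drawing: "walk V E xs \<Longrightarrow> walk_image emb xs \<subseteq> drawing"
  unfolding walk_image_conv_nth drawing_def walk_def by blast

lemma compact_walk_image: "walk V E xs \<Longrightarrow> compact (walk_image emb xs)"
  by (induction xs rule: induct_list012) (auto simp: compact_arc_image arc_emb)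

lemma walk_image_vertices:
  assumes "walk V E xs" "v \<in> V" "pos v \<in> walk_image emb xs"
  shows "v \<in> set xs"
  using assms
proof (induction xs rule: induct_list012)
  case (3 x y zs)
  show ?case
  proof (cases "pos v \<in> path_image (emb x y)")
    case True
    then have "pos v \<in> {pos x, pos y}"
      using image_emb_vertices[of x y] 3 by auto
    then show ?thesis
      using inj_pos 3 edge_in_V[of x y] by (auto dest: inj_onD)
  qed (use 3 in auto)
qed auto

lemma edge_Int_walk_image:
  assumes "walk V E xs" "E u v"
    and "\<And>i. Suc i < length xs \<Longrightarrow> {u, v} \<noteq> {xs ! i, xs ! Suc i}"
  shows "path_image (emb u v) \<inter> walk_image emb xs \<subseteq> pos ` ({u, v} \<inter> set xs)"
proof
  fix z assume "z \<in> path_image (emb u v) \<inter> walk_image emb xs"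
  then obtain i where i: "Suc i < length xs" "z \<in> path_image (emb (xs ! i) (xs ! Suc i))" "z \<in> path_image (emb u v)"
    unfolding walk_image_conv_nth by blast
  then have "E (xs ! i) (xs ! Suc i)"
    using assms(1) unfolding walk_def by blast
  then have "z \<in> pos ` ({u, v} \<inter> {xs ! i, xs ! Suc i})"
    using image_emb_Int[OF assms(2)] assms(3)[OF i(1)] i by blast
  then show "z \<in> pos ` ({u, v} \<inter> set xs)"
    using i(1) by auto
qed

text \<open>Either the walk traverses the edge in some direction, or the edge differs from all its
  edges and can meet them only in common vertices.\<close>

lemma edge_subset_or_Int_walk_image:
  assumes "walk V E xs" "E u v"
  shows "path_image (emb u v) \<subseteq> walk_image emb xs \<or>
    path_image (emb u v) \<inter> walk_image emb xs \<subseteq> pos ` ({u, v} \<inter> set xs)"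
proof (cases "\<exists>i. Suc i < length xs \<and> {u, v} = {xs ! i, xs ! Suc i}")
  case True
  then obtain i where i: "Suc i < length xs" "{u, v} = {xs ! i, xs ! Suc i}"
    by blast
  then have "path_image (emb u v) = path_image (emb (xs ! i) (xs ! Suc i))"
    using image_emb_commute[OF assms(2)] by (auto simp: doubleton_eq_iff)
  then show ?thesis
    using i(1) unfolding walk_image_conv_nth by blast
next
  case False
  then show ?thesis
    using edge_Int_walk_image[OF assms] by blast
qed

lemma walk_path_props:
  assumes "walk V E xs" "2 \<le> length xs"
  shows "path (walk_path emb xs)" "pathstart (walk_path emb xs) = pos (hd xs)"
    "pathfinish (walk_path emb xs) = pos (last xs)" "path_image (walk_path emb xs) = walk_image emb xs"
proof -
  have "path (walk_path emb xs) \<and> pathstart (walk_path emb xs) = pos (hd xs) \<and>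
    pathfinish (walk_path emb xs) = pos (last xs) \<and> path_image (walk_path emb xs) = walk_image emb xs"
    using assms
  proof (induction xs rule: induct_list012)
    case (3 x y zs)
    then have e: "path (emb x y)" "pathstart (emb x y) = pos x" "pathfinish (emb x y) = pos y"
      using path_emb pathstart_emb pathfinish_emb by auto
    show ?case
    proof (cases zs)
      case Nil
      then show ?thesis
        using e by simp
    next
      case (Cons z zs')
      then show ?thesis
        using e 3 by (simp add: path_image_join)
    qed
  qed auto
  then show "path (walk_path emb xs)" "pathstart (walk_path emb xs) = pos (hd xs)"
    "pathfinish (walk_path emb xs) = pos (last xs)" "path_image (walk_path emb xs) = walk_image emb xs"
    by auto
qed

lemma winding_number_walk_path:
  assumes "walk V E xs" "2 \<le> length xs" "p \<notin> drawing"
  shows "winding_number (walk_path emb xs) p = walk_weight (edge_winding p) xs"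
  using assms
proof (induction xs rule: induct_list012)
  case (3 x y zs)
  show ?case
  proof (cases zs)
    case Nil
    then show ?thesis
      by (simp add: edge_winding_def)
  next
    case (Cons z zs')
    have W: "walk V E (y # zs)" "2 \<le> length (y # zs)"
      using 3 Cons by auto
    note P = walk_path_props[OF W]
    have "p \<notin> path_image (walk_path emb (y # zs))" "p \<notin> path_image (emb x y)"
      using P(4) walk_image_subset_drawing[OF W(1)] image_emb_subset_drawing[of x y] 3 by auto
    moreover have "path (emb x y)" "pathfinish (emb x y) = pathstart (walk_path emb (y # zs))"
      using P(2) 3 path_emb pathfinish_emb by auto
    ultimately have "winding_number (emb x y +++ walk_path emb (y # zs)) p =
        winding_number (emb x y) p + winding_number (walk_path emb (y # zs)) p"
      using P(1) by (intro winding_number_join) auto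
    then show ?thesis
      using 3 Cons by (simp add: edge_winding_def)
  qed
qed auto

text \<open>As \<open>x\<close> does not recur, the first edge differs from all later ones and meets
  them only in \<open>pos y\<close>, so joining it preserves the arc.\<close>

lemma arc_walk_path:
  assumes "walk V E xs" "2 \<le> length xs" "distinct xs"
  shows "arc (walk_path emb xs)"
  using assms
proof (induction xs rule: induct_list012)
  case (3 x y zs)
  show ?case
  proof (cases zs)
    case Nil
    then show ?thesis
      using 3 arc_emb by simp
  next
    case (Cons z zs')
    have W: "walk V E (y # zs)" "2 \<le> length (y # zs)" and xy: "E x y"
      using 3 Cons by auto
    note P = walk_path_props[OF W]
    have "{x, y} \<noteq> {(y # zs) ! i, (y # zs) ! Suc i}" if "Suc i < length (y # zs)" for i
    proof -
      have "x \<notin> {(y # zs) ! i, (y # zs) ! Suc i}"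
        using nth_mem[OF that] nth_mem[OF Suc_lessD[OF that]] 3(5) by auto
      then show ?thesis
        by blast
    qed
    from edge_Int_walk_image[OF W(1) xy this]
    have "path_image (emb x y) \<inter> path_image (walk_path emb (y # zs)) \<subseteq> {pos y}"
      using 3(5) P(4) by auto
    then have "arc (emb x y +++ walk_path emb (y # zs))"
      using P 3 W arc_emb[OF xy] pathfinish_emb[OF xy] by (intro arc_join) auto
    then show ?thesis
      using Cons by simp
  qed
qed auto

text \<open>The weight is the winding number of a closed path, which vanishes at points outside its
  image. A walk with fewer than two vertices has weight zero.\<close>

lemma closed_walk_weight_imp_inside:
  assumes "walk V E L" "hd L = last L" "p \<notin> drawing" "walk_weight (edge_winding p) L \<noteq> 0"
  shows "p \<in> inside (walk_image emb L)"
proof -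
  have L: "2 \<le> length L"
  proof (rule ccontr)
    assume "\<not> 2 \<le> length L"
    then have "walk_weight (edge_winding p) L = 0"
      by (cases "(edge_winding p, L)" rule: walk_weight.cases) auto
    with assms show False
      by simp
  qed
  note P = walk_path_props[OF assms(1) L]
  have "p \<notin> outside (walk_image emb L)"
    using winding_number_zero_in_outside[OF P(1)] P winding_number_walk_path[OF assms(1) L assms(3)] assms
    by auto
  then show ?thesis
    using walk_image_subset_drawing[OF assms(1)] assms(3) by (auto simp: inside_outside)
qed

lemma cycle_walk:
  assumes "is_cycle V E C"
  shows "walk V E C" "E (last C) (hd C)" "walk V E (C @ [hd C])" "C \<noteq> []"
proof -
  have C: "length C \<ge> 3" "set C \<subseteq> V"
    "\<And>i. i < length C \<Longrightarrow> E (C ! i) (C ! ((i + 1) mod length C))"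
    using assms unfolding is_cycle_def by auto
  then show "C \<noteq> []"
    by auto
  show W: "walk V E C"
    unfolding walk_def
  proof (intro conjI allI impI)
    show "E (C ! i) (C ! Suc i)" if "Suc i < length C" for i
      using C(3)[of i] that by simp
  qed (use C in auto)
  show e: "E (last C) (hd C)"
    using C(3)[of "length C - 1"] \<open>C \<noteq> []\<close> by (simp add: last_conv_nth hd_conv_nth)
  have "walk V E (C @ tl [last C, hd C])"
    using W e edge_in_V[OF e] by (intro walk_join) auto
  then show "walk V E (C @ [hd C])"
    by simp
qed

text \<open>A cycle is drawn as a simple closed path, whose winding number about each inside point
  has modulus 1.\<close>

lemma cycle_weight_nonzero:
  assumes C: "is_cycle V E C" and p: "p \<notin> drawing" "p \<in> inside (walk_image emb (C @ [hd C]))"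
  shows "walk_weight (edge_winding p) (C @ [hd C]) \<noteq> 0"
proof -
  note cw = cycle_walk[OF C]
  have len: "length C \<ge> 3" and dist: "distinct C"
    using C unfolding is_cycle_def by auto
  then have len2: "2 \<le> length C"
    by simp
  note P = walk_path_props[OF cw(1) len2]
  define g where "g = walk_path emb C +++ emb (last C) (hd C)"
  \<comment> \<open>By distinctness the closing edge could only repeat an edge of the open path if
    the cycle had two vertices.\<close>
  have "{last C, hd C} \<noteq> {C ! i, C ! Suc i}" if "Suc i < length C" for i
  proof
    assume "{last C, hd C} = {C ! i, C ! Suc i}"
    then have "{C ! (length C - 1), C ! 0} = {C ! i, C ! Suc i}"
      using cw(4) by (simp add: last_conv_nth hd_conv_nth)
    moreover have "C ! 0 = C ! j \<longleftrightarrow> j = 0" "C ! (length C - 1) = C ! j \<longleftrightarrow> j = length C - 1"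
      if "j < length C" for j
      using nth_eq_iff_index_eq[OF dist _ that] that by (metis gr_zeroI less_zeroE, metis diff_less less_nat_zero_code neq0_conv zero_less_one)
    from this[of i] this[of "Suc i"] this[of 0] have "C ! 0 = C ! i \<longleftrightarrow> i = 0" "C ! 0 \<noteq> C ! Suc i"
      "C ! (length C - 1) \<noteq> C ! i" "C ! (length C - 1) = C ! Suc i \<longleftrightarrow> Suc i = length C - 1"
      using that by auto
    ultimately show False
      using len by (auto simp: doubleton_eq_iff)
  qed
  from edge_Int_walk_image[OF cw(1,2) this]
  have "path_image (emb (last C) (hd C)) \<inter> path_image (walk_path emb C) \<subseteq> {pos (last C), pos (hd C)}"
    using P(4) by auto
  then have "simple_path g"
    unfolding g_def using P arc_walk_path[OF cw(1) len2 dist] arc_emb[OF cw(2)]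
      pathstart_emb[OF cw(2)] pathfinish_emb[OF cw(2)]
    by (intro simple_path_join_loop) auto
  moreover have "path_image g = walk_image emb (C @ [hd C])"
    unfolding g_def using P pathstart_emb[OF cw(2)] cw(4)
    by (simp add: path_image_join walk_image_append)
  ultimately have "norm (winding_number g p) = 1"
    using p by (intro simple_closed_path_norm_winding_number_inside) auto
  moreover have "winding_number g p = walk_weight (edge_winding p) C + edge_winding p (last C) (hd C)"
  proof -
    have "p \<notin> path_image (walk_path emb C)" "p \<notin> path_image (emb (last C) (hd C))"
      using P(4) walk_image_subset_drawing[OF cw(1)] image_emb_subset_drawing[OF cw(2)] p(1) by auto
    then have "winding_number g p = winding_number (walk_path emb C) p + winding_number (emb (last C) (hd C)) p"
      unfolding g_def using P path_emb[OF cw(2)] pathstart_emb[OF cw(2)]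
      by (intro winding_number_join) auto
    then show ?thesis
      using winding_number_walk_path[OF cw(1) len2 p(1)] by (simp add: edge_winding_def)
  qed
  moreover have "walk_weight (edge_winding p) (C @ [hd C]) =
      walk_weight (edge_winding p) C + edge_winding p (last C) (hd C)"
    using walk_weight_join[of C "[last C, hd C]" "edge_winding p"] cw(4) by simp
  ultimately show ?thesis
    by auto
qed

section \<open>Counting the faces inside short walks and inside cycles\<close>

text \<open>The vertices strictly inside are finitely many, as they lie in a bounded set and do not
  accumulate; non-amenability then bounds them by \<open>f l\<close>. Together with those of
  \<open>L\<close> they span a finite subdrawing \<open>X\<close> that has the same faces inside the
  walk. Its edges are counted by ordered pairs of vertices, hence the square.\<close>

lemma card_faces_inside_walk:
  assumes L: "walk V E L" and nolim: "\<And>z. \<not> z islimpt (pos ` V)"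
    and f: "mono f" "\<And>S. S \<subseteq> V \<Longrightarrow> finite S \<Longrightarrow> S \<noteq> {} \<Longrightarrow> card S \<le> f (card (vboundary V E S))"
    and len: "length L \<le> l"
  shows "finite {F \<in> components (- drawing). F \<subseteq> inside (walk_image emb L)} \<and>
    card {F \<in> components (- drawing). F \<subseteq> inside (walk_image emb L)} \<le> (f l + l)\<^sup>2"
proof -
  define K where "K = walk_image emb L"
  have K: "compact K" "closed K" "bounded (inside K)"
    using compact_walk_image[OF L] unfolding K_def
    by (auto simp: compact_imp_closed compact_imp_bounded bounded_inside)
  define S where "S = {v \<in> V. pos v \<in> inside K}"
  define T where "T = S \<union> set L"
  have TV: "T \<subseteq> V"
    using L unfolding T_def S_def walk_def by auto
  have "finite (pos ` S)"
  proof (rule ccontr)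
    assume "infinite (pos ` S)"
    moreover have "bounded (pos ` S)"
      by (rule bounded_subset[OF K(3)]) (auto simp: S_def)
    ultimately obtain z where "z islimpt (pos ` S)"
      using bounded_infinite_imp_islimpt by blast
    then have "z islimpt (pos ` V)"
      by (rule islimpt_subset) (auto simp: S_def)
    with nolim show False
      by blast
  qed
  then have finS: "finite S"
    using inj_pos by (metis (no_types, lifting) S_def finite_imageD inj_on_subset mem_Collect_eq subsetI)
  \<comment> \<open>An edge leaving \<open>S\<close> must meet \<open>K\<close> without lying in it,
    so it meets \<open>K\<close> at a vertex of \<open>L\<close>. That vertex is not
    \<open>s\<close>, whose position is off \<open>K\<close>.\<close>
  have "vboundary V E S \<subseteq> set L"
  proof
    fix u assume "u \<in> vboundary V E S"
    then obtain s where s: "s \<in> S" "E s u" "u \<in> V" "u \<notin> S"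
      unfolding vboundary_def by blast
    have "pos s \<in> path_image (emb s u)" "pos u \<in> path_image (emb s u)"
      using pathstart_emb[OF s(2)] pathfinish_emb[OF s(2)] pathstart_in_path_image pathfinish_in_path_image
      by metis+
    moreover have "pos s \<in> inside K" "pos s \<notin> K"
      using s(1) unfolding S_def inside_def by auto
    moreover have "connected (path_image (emb s u))"
      using arc_emb[OF s(2)] by (simp add: connected_arc_image)
    ultimately have "path_image (emb s u) \<inter> K \<noteq> {}" "\<not> path_image (emb s u) \<subseteq> K"
      using connected_subset_inside[of "path_image (emb s u)" K] s unfolding S_def by auto
    then have "path_image (emb s u) \<inter> K \<subseteq> pos ` ({s, u} \<inter> set L)"
      using edge_subset_or_Int_walk_image[OF L s(2)] unfolding K_def by blast
    then show "u \<in> set L"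
      using \<open>path_image (emb s u) \<inter> K \<noteq> {}\<close> \<open>pos s \<notin> K\<close> by auto
  qed
  then have "card (vboundary V E S) \<le> card (set L)"
    by (intro card_mono) auto
  then have "card (vboundary V E S) \<le> l"
    using card_length[of L] len by linarith
  moreover have "S \<subseteq> V"
    unfolding S_def by blast
  ultimately have cardS: "card S \<le> f l"
    using f(2)[of S] finS monoD[OF f(1), of "card (vboundary V E S)" l]
      \<open>S \<subseteq> V\<close> by (cases "S = {}") auto
  have finT: "finite T"
    using finS unfolding T_def by simp
  have cardT: "card T \<le> f l + l"
    using card_Un_le[of S "set L"] cardS card_length[of L] len unfolding T_def by linarith
  define \<A> where "\<A> = {path_image (emb u v) |u v. E u v \<and> u \<in> T \<and> v \<in> T}"
  define X where "X = pos ` T \<union> \<Union>\<A>"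
  have \<A>sub: "\<A> \<subseteq> (\<lambda>(u, v). path_image (emb u v)) ` (T \<times> T)"
    unfolding \<A>_def by auto
  then have fin\<A>: "finite \<A>"
    using finT by (meson finite_SigmaI finite_imageI finite_subset)
  have "card \<A> \<le> card (T \<times> T)"
    using \<A>sub finT by (metis card_image_le card_mono finite_SigmaI finite_imageI le_trans)
  then have card\<A>: "card \<A> \<le> (f l + l)\<^sup>2"
    using mult_le_mono[OF cardT cardT] by (simp add: power2_eq_square card_cartesian_product)
  have bc: "finite {U \<in> components (- X). bounded U} \<and> card {U \<in> components (- X). bounded U} \<le> card \<A>"
    unfolding X_def
  proof (rule card_bounded_components_arcs)
    show "\<exists>g. arc g \<and> path_image g = A \<and> A \<inter> pos ` T \<subseteq> {pathstart g, pathfinish g}" if A: "A \<in> \<A>" for A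
    proof -
      obtain u v where uv: "E u v" "A = path_image (emb u v)"
        using A unfolding \<A>_def by blast
      then show ?thesis
        using arc_emb[OF uv(1)] pathstart_emb[OF uv(1)] pathfinish_emb[OF uv(1)]
          image_emb_vertices[OF uv(1)] TV by (intro exI[of _ "emb u v"]) auto
    qed
    show "A \<inter> B \<subseteq> pos ` T" if AB: "A \<in> \<A>" "B \<in> \<A>" "A \<noteq> B" for A B
    proof -
      obtain u v x y where uv: "E u v" "A = path_image (emb u v)" "u \<in> T" "v \<in> T"
        and xy: "E x y" "B = path_image (emb x y)"
        using AB unfolding \<A>_def by blast
      have "{u, v} \<noteq> {x, y}"
        using image_emb_commute[OF uv(1)] uv xy \<open>A \<noteq> B\<close> by (auto simp: doubleton_eq_iff)
      then show ?thesis
        using image_emb_Int[OF uv(1) xy(1)] uv xy by blast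
    qed
  qed (use finT fin\<A> in auto)
  have X_drawing: "X \<subseteq> drawing"
    using TV unfolding X_def \<A>_def drawing_def by blast
  have K_X: "K \<subseteq> X"
  proof
    fix z assume "z \<in> K"
    then obtain i where i: "Suc i < length L" "z \<in> path_image (emb (L ! i) (L ! Suc i))"
      unfolding K_def walk_image_conv_nth by blast
    then have "E (L ! i) (L ! Suc i)" "L ! i \<in> T" "L ! Suc i \<in> T"
      using L unfolding walk_def T_def by auto
    then show "z \<in> X"
      using i(2) unfolding X_def \<A>_def by blast
  qed
  \<comment> \<open>If a non-vertex point of an edge lies inside \<open>K\<close>, the open edge
    misses \<open>K\<close> and stays inside. Its ends then lie inside or on \<open>K\<close>, so
    both belong to \<open>T\<close>.\<close>
  have inside_X: "inside K \<inter> drawing \<subseteq> X"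
  proof
    fix z assume z: "z \<in> inside K \<inter> drawing"
    show "z \<in> X"
    proof (cases "z \<in> pos ` V")
      case True
      then show ?thesis
        using z unfolding X_def T_def S_def by auto
    next
      case False
      then obtain u v where uv: "E u v" "z \<in> path_image (emb u v)"
        using z unfolding drawing_def by blast
      define e where "e = path_image (emb u v) - {pos u, pos v}"
      have "connected e"
        using connected_simple_path_endless[OF arc_imp_simple_path[OF arc_emb[OF uv(1)]]]
        by (simp add: e_def pathstart_emb[OF uv(1)] pathfinish_emb[OF uv(1)])
      moreover have "z \<in> e"
        using uv False edge_in_V[OF uv(1)] unfolding e_def by auto
      moreover have "e \<inter> K = {}"
      proof -
        have "z \<notin> K"
          using z inside_no_overlap[of K] by blast
        then have "path_image (emb u v) \<inter> K \<subseteq> pos ` ({u, v} \<inter> set L)"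
          using edge_subset_or_Int_walk_image[OF L uv(1)] uv(2) unfolding K_def by blast
        then show ?thesis
          unfolding e_def by auto
      qed
      ultimately have "e \<subseteq> inside K"
        using z by (intro connected_subset_inside) auto
      then have "closure e \<subseteq> K \<union> inside K"
        using closure_inside_subset[OF K(2)] closure_mono by blast
      moreover have "path_image (emb u v) \<subseteq> closure e"
        using arc_endpoints_in_closure[OF arc_emb[OF uv(1)]]
        by (simp add: e_def pathstart_emb[OF uv(1)] pathfinish_emb[OF uv(1)])
      moreover have "pos u \<in> path_image (emb u v)" "pos v \<in> path_image (emb u v)"
        using pathstart_emb[OF uv(1)] pathfinish_emb[OF uv(1)] pathstart_in_path_image pathfinish_in_path_image
        by metis+
      ultimately have "pos u \<in> K \<union> inside K" "pos v \<in> K \<union> inside K"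
        by auto
      then have "u \<in> T" "v \<in> T"
        using walk_image_vertices[OF L] edge_in_V[OF uv(1)] unfolding T_def S_def K_def by auto
      then show ?thesis
        using uv unfolding X_def \<A>_def by blast
    qed
  qed
  have "{F \<in> components (- drawing). F \<subseteq> inside K} \<subseteq> {U \<in> components (- X). bounded U}"
  proof
    fix F assume "F \<in> {F \<in> components (- drawing). F \<subseteq> inside K}"
    then have F: "F \<in> components (- drawing)" "F \<subseteq> inside K"
      by auto
    \<comment> \<open>A connected set avoiding \<open>X\<close> also avoids \<open>K\<close>, so it
      cannot leave the inside, where \<open>X\<close> contains all of the drawing. Thus a face
      remains maximal when the drawing is thinned to \<open>X\<close>.\<close>
    have "D = F" if D: "F \<subseteq> D" "D \<subseteq> - X" "connected D" for D
    proof -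
      have "F \<noteq> {}"
        using F(1) in_components_nonempty by blast
      then have "D \<subseteq> inside K"
        using D K_X F(2) by (intro connected_subset_inside) auto
      then have "D \<subseteq> - drawing"
        using inside_X D(2) by blast
      then show ?thesis
        using F(1) D \<open>F \<noteq> {}\<close> unfolding in_components_maximal by auto
    qed
    moreover have "F \<noteq> {}" "F \<subseteq> - X" "connected F"
      using F(1) X_drawing unfolding in_components_maximal by auto
    ultimately have "F \<in> components (- X)"
      unfolding in_components_maximal[of F "- X"] by blast
    then show "F \<in> {U \<in> components (- X). bounded U}"
      using F(2) K(3) bounded_subset by blast
  qed
  then show ?thesis
    using bc card\<A> unfolding K_def[symmetric] by (meson card_mono finite_subset le_trans)
qed

text \<open>Dehn's algorithm yields at most \<open>length C\<close> short closed walks whose weights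
  sum to that of the cycle. About a point of a face inside the cycle this sum is nonzero, so some
  short walk has nonzero weight there and encloses the face.\<close>

theorem card_faces_inside_cycle:
  assumes nolim: "\<And>z. \<not> z islimpt (pos ` V)"
    and hyp: "hyperbolic_graph V E" and amen: "weakly_non_amenable V E"
  shows "\<exists>k. \<forall>C. is_cycle V E C \<longrightarrow>
    finite {F \<in> components (- drawing). F \<subseteq> inside (walk_image emb (C @ [hd C]))} \<and>
    card {F \<in> components (- drawing). F \<subseteq> inside (walk_image emb (C @ [hd C]))} \<le> k * length C"
proof -
  obtain f :: "nat \<Rightarrow> nat" where f: "mono f"
    "\<And>S. S \<subseteq> V \<Longrightarrow> finite S \<Longrightarrow> S \<noteq> {} \<Longrightarrow> card S \<le> f (card (vboundary V E S))"
    using amen unfolding weakly_non_amenable_def by blast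
  obtain \<delta> where \<delta>: "thin_triangles V E \<delta>"
    using hyperbolic_graph_thin_triangles[OF hyp] by blast
  define m where "m = 2 * \<delta> + 1"
  \<comment> \<open>The face count for one closed walk with at most \<open>4 * m\<close>
    vertices.\<close>
  define k where "k = (f (4 * m) + 4 * m)\<^sup>2"
  define \<F> where "\<F> K = {F \<in> components (- drawing). F \<subseteq> inside K}" for K
  have "finite (\<F> (walk_image emb (C @ [hd C]))) \<and> card (\<F> (walk_image emb (C @ [hd C]))) \<le> k * length C"
    if C: "is_cycle V E C" for C
  proof -
    note cw = cycle_walk[OF C]
    have "hd (C @ [hd C]) = last (C @ [hd C])" "length (C @ [hd C]) = Suc (length C)"
      using cw(4) by auto
    from hyperbolic_closed_walk_decomposition[OF graph \<delta> m_def cw(3) this]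
    obtain Ls where Ls: "length Ls \<le> length C"
      "\<And>L. L \<in> set Ls \<Longrightarrow> walk V E L \<and> hd L = last L \<and> length L \<le> 4 * m"
      "\<And>w :: 'v \<Rightarrow> 'v \<Rightarrow> complex. \<forall>u v. E u v \<longrightarrow> w v u = - w u v \<Longrightarrow>
        walk_weight w (C @ [hd C]) = (\<Sum>L\<leftarrow>Ls. walk_weight w L)"
      by blast
    have "\<F> (walk_image emb (C @ [hd C])) \<subseteq> (\<Union>L\<in>set Ls. \<F> (walk_image emb L))"
    proof
      fix F assume "F \<in> \<F> (walk_image emb (C @ [hd C]))"
      then have F: "F \<in> components (- drawing)" "F \<subseteq> inside (walk_image emb (C @ [hd C]))"
        by (auto simp: \<F>_def)
      then obtain p where p: "p \<in> F" "p \<notin> drawing"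
        using in_components_nonempty in_components_subset by blast
      have "walk_weight (edge_winding p) (C @ [hd C]) \<noteq> 0"
        using cycle_weight_nonzero[OF C p(2)] F p by auto
      moreover have "walk_weight (edge_winding p) (C @ [hd C]) = (\<Sum>L\<leftarrow>Ls. walk_weight (edge_winding p) L)"
        using edge_winding_commute p(2) by (intro Ls(3)) auto
      ultimately obtain L where L: "L \<in> set Ls" "walk_weight (edge_winding p) L \<noteq> 0"
        by (metis (no_types, lifting) sum_list_0 map_eq_conv)
      then have "p \<in> inside (walk_image emb L)"
        using Ls(2)[OF L(1)] closed_walk_weight_imp_inside[OF _ _ p(2)] by auto
      \<comment> \<open>One point suffices: the face is connected and misses the walk, so all of it
        lies inside.\<close>
      moreover have "F \<inter> walk_image emb L = {}"
        using walk_image_subset_drawing Ls(2)[OF L(1)] in_components_subset[OF F(1)] by blast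
      ultimately have "F \<subseteq> inside (walk_image emb L)"
        using p(1) in_components_connected[OF F(1)] by (intro connected_subset_inside) auto
      then show "F \<in> (\<Union>L\<in>set Ls. \<F> (walk_image emb L))"
        using F(1) L(1) by (auto simp: \<F>_def)
    qed
    moreover have fL: "finite (\<F> (walk_image emb L))" "card (\<F> (walk_image emb L)) \<le> k" if "L \<in> set Ls" for L
      using card_faces_inside_walk[of L f "4 * m"] Ls(2)[OF that] nolim f unfolding \<F>_def k_def by auto
    ultimately have "finite (\<F> (walk_image emb (C @ [hd C])))"
      and "card (\<F> (walk_image emb (C @ [hd C]))) \<le> card (\<Union>L\<in>set Ls. \<F> (walk_image emb L))"
      by (auto intro: finite_subset card_mono)
    moreover have "card (\<Union>L\<in>set Ls. \<F> (walk_image emb L)) \<le> (\<Sum>L\<in>set Ls. card (\<F> (walk_image emb L)))"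
      by (rule card_UN_le) simp
    moreover have "\<dots> \<le> card (set Ls) * k"
      using sum_bounded_above[of "set Ls" "\<lambda>L. card (\<F> (walk_image emb L))" k] fL(2) by simp
    moreover have "card (set Ls) * k \<le> k * length C"
      using card_length[of Ls] Ls(1) by (simp add: mult.commute)
    ultimately show ?thesis
      by linarith
  qed
  then show ?thesis
    unfolding \<F>_def by blast
qed

end


section \<open>Transfer from the complex plane to \<open>real^2\<close>\<close>

lemma components_homeomorphism:
  assumes "homeomorphism A B f g"
  shows "components B = (`) f ` components A"
proof -
  have "B = f ` A"
    using assms by (simp add: homeomorphism_def)
  then have "components B = (\<lambda>x. connected_component_set B (f x)) ` A"
    unfolding components_def by (simp add: image_image)
  also have "\<dots> = (\<lambda>x. f ` connected_component_set A x) ` A"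
    using connected_component_set_homeomorphism[OF assms] by (intro image_cong) auto
  finally show ?thesis
    unfolding components_def by (simp add: image_image)
qed

lemma homeomorphism_Compl_image:
  assumes "homeomorphism UNIV UNIV f g"
  shows "homeomorphism (- S) (- (f ` S)) f g"
proof (rule homeomorphism_of_subsets[OF assms])
  have "bij f"
    using assms by (metis bij_betw_def bij_betw_byWitness homeomorphism_def UNIV_I inj_on_inverseI)
  then show "f ` (- S) = - (f ` S)"
    by (rule bij_image_Compl_eq)
qed auto

text \<open>A homeomorphism matches the components of the complements; linearity in both directions
  ensures that bounded ones correspond to bounded ones.\<close>

lemma inside_linear_image:
  fixes f :: "'a::euclidean_space \<Rightarrow> 'b::euclidean_space"
  assumes f: "linear f" and g: "linear g" and h: "homeomorphism UNIV UNIV f g"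
  shows "inside (f ` S) = f ` inside S"
proof -
  have gf: "g (f x) = x" "f (g y) = y" for x y
    using h by (auto simp: homeomorphism_def)
  have b: "bounded (f ` T) \<longleftrightarrow> bounded T" for T
    using bounded_linear_image[of T f] bounded_linear_image[of "f ` T" g] f g gf
    by (auto simp: image_image linear_conv_bounded_linear)
  have "f x \<in> inside (f ` S) \<longleftrightarrow> x \<in> inside S" for x
    using connected_component_set_homeomorphism[OF homeomorphism_Compl_image[OF h], of x S] b gf
    unfolding inside_def by (auto simp: image_iff) (metis gf)+
  then show ?thesis
    using gf by (metis (no_types, lifting) image_iff subsetI subset_antisym)
qed

lemma walk_image_compose: "walk_image (\<lambda>u v. f \<circ> emb u v) xs = f ` walk_image emb xs"
  by (induction xs rule: induct_list012) (simp_all add: path_image_def image_Un image_image)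

theorem lemma5p2:
  fixes V :: "'v set" and E :: "'v \<Rightarrow> 'v \<Rightarrow> bool"
    and pos :: "'v \<Rightarrow> real^2" and emb :: "'v \<Rightarrow> 'v \<Rightarrow> real \<Rightarrow> real^2"
  assumes "plane_graph V E pos emb"
    and "\<forall>z. \<not> z islimpt (pos ` V)"
    and "bounded_degree V E"
    and "hyperbolic_graph V E"
    and "weakly_non_amenable V E"
  shows "\<exists>k::nat. \<forall>C. is_cycle V E C \<longrightarrow>
           finite (faces_inside V E pos emb C) \<and>
           card (faces_inside V E pos emb C) \<le> k * length C"
proof -
  \<comment> \<open>Equal dimensions give a linear isomorphism, along which the whole drawing is
    moved to the complex plane.\<close>
  have "DIM(real^2) = DIM(complex)"
    by simp
  then obtain f :: "real^2 \<Rightarrow> complex" and g where f: "linear f" and g: "linear g"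
    and gf: "\<And>x. g (f x) = x" "\<And>y. f (g y) = y"
    using isomorphisms_UNIV_UNIV by metis
  have "continuous_on UNIV f" "continuous_on UNIV g"
    using f g by (auto intro: linear_continuous_on simp: linear_conv_bounded_linear)
  then have h: "homeomorphism UNIV UNIV f g"
    using gf by (auto simp: homeomorphism_def image_iff) (metis gf)+
  have inj: "inj f"
    using gf by (metis injI)
  define pos' where "pos' = f \<circ> pos"
  define emb' where "emb' u v = f \<circ> emb u v" for u v
  have G: "simple_graph V E" "inj_on pos V"
    and edge: "\<And>u v. E u v \<Longrightarrow> arc (emb u v) \<and> pathstart (emb u v) = pos u \<and>
      pathfinish (emb u v) = pos v \<and> path_image (emb v u) = path_image (emb u v) \<and>
      path_image (emb u v) \<inter> pos ` V \<subseteq> {pos u, pos v}"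
    and cross: "\<And>u v x y. E u v \<Longrightarrow> E x y \<Longrightarrow> {u, v} \<noteq> {x, y} \<Longrightarrow>
      path_image (emb u v) \<inter> path_image (emb x y) \<subseteq> pos ` ({u, v} \<inter> {x, y})"
    using assms(1) unfolding plane_graph_def by blast+
  have image: "path_image (emb' u v) = f ` path_image (emb u v)" for u v
    by (simp add: emb'_def path_image_compose)
  interpret plane_drawing V E pos' emb'
  proof
    show "inj_on pos' V"
      using G(2) inj unfolding pos'_def by (intro comp_inj_on) (auto intro: inj_on_subset)
    show "arc (emb' u v)" "pathstart (emb' u v) = pos' u" "pathfinish (emb' u v) = pos' v"
      "path_image (emb' v u) = path_image (emb' u v)" if "E u v" for u v
      using edge[OF that] arc_linear_image_eq[OF f inj]
      by (simp_all add: image) (simp_all add: emb'_def pos'_def pathstart_compose pathfinish_compose)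
    show "path_image (emb' u v) \<inter> pos' ` V \<subseteq> {pos' u, pos' v}" if "E u v" for u v
    proof -
      have "path_image (emb' u v) \<inter> pos' ` V = f ` (path_image (emb u v) \<inter> pos ` V)"
        using image_Int[OF inj] by (simp add: image pos'_def image_comp)
      then show ?thesis
        using edge[OF that] by (auto simp: pos'_def)
    qed
    show "path_image (emb' u v) \<inter> path_image (emb' x y) \<subseteq> pos' ` ({u, v} \<inter> {x, y})"
      if "E u v" "E x y" "{u, v} \<noteq> {x, y}" for u v x y
    proof -
      have "path_image (emb' u v) \<inter> path_image (emb' x y) = f ` (path_image (emb u v) \<inter> path_image (emb x y))"
        using image_Int[OF inj] by (simp add: image)
      also have "\<dots> \<subseteq> f ` pos ` ({u, v} \<inter> {x, y})"
        using cross[OF that] by (rule image_mono)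
      finally show ?thesis
        by (simp add: pos'_def image_comp)
    qed
  qed (rule G)
  have nolim: "\<not> z islimpt (pos' ` V)" for z
  proof
    assume "z islimpt (pos' ` V)"
    moreover have "isCont g z"
      using \<open>continuous_on UNIV g\<close> by (simp add: continuous_on_eq_continuous_at)
    moreover have "eventually (\<lambda>y. g y \<noteq> g z) (at z)"
      using eventually_neq_at_within[of z] by (rule eventually_mono) (metis gf(2))
    ultimately have "g z islimpt (g ` pos' ` V)"
      by (rule islimpt_isCont_image)
    then show False
      using assms(2) gf(1) by (simp add: pos'_def image_image)
  qed
  have drawing: "drawing = f ` graph_image V E pos emb"
  proof -
    have "f ` \<Union>{path_image (emb u v) |u v. E u v} = \<Union>{path_image (emb' u v) |u v. E u v}"
      unfolding image by blast
    then show ?thesis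
      unfolding drawing_def graph_image_def image_Un by (simp add: pos'_def image_comp)
  qed
  define \<F> where "\<F> C = {F \<in> components (- drawing). F \<subseteq> inside (walk_image emb' (C @ [hd C]))}" for C
  have faces: "\<F> C = (`) f ` faces_inside V E pos emb C" if "is_cycle V E C" for C
  proof -
    have "C \<noteq> []"
      using cycle_walk[OF that] by simp
    then have "walk_image emb' (C @ [hd C]) = f ` cycle_image emb C"
      by (simp add: cycle_image_conv_walk_image emb'_def[abs_def] walk_image_compose)
    then have "inside (walk_image emb' (C @ [hd C])) = f ` inside (cycle_image emb C)"
      using inside_linear_image[OF f g h] by simp
    moreover have "components (- drawing) = (`) f ` faces V E pos emb"
      unfolding faces_def drawing by (rule components_homeomorphism[OF homeomorphism_Compl_image[OF h]])
    ultimately show ?thesis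
      unfolding \<F>_def faces_inside_def by (auto simp: inj_image_subset_iff[OF inj])
  qed
  obtain k where k: "\<And>C. is_cycle V E C \<Longrightarrow> finite (\<F> C) \<and> card (\<F> C) \<le> k * length C"
    using card_faces_inside_cycle[OF nolim assms(4,5)] unfolding \<F>_def by blast
  \<comment> \<open>Distinct faces have distinct images, so finiteness and cardinality carry
    back.\<close>
  have "inj_on ((`) f) (faces_inside V E pos emb C)" for C
    using inj by (auto intro: inj_onI simp: inj_image_eq_iff)
  then show ?thesis
    using k faces by (intro exI[of _ k]) (metis card_image finite_imageD)
qed

end
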